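(* Let $n\in\mathbb{N}$ and let $T$ be the monoid with identity element $e$ generated by $\sigma_i,\tau_i$, $i=1,\dots,n-1$, subject to the relations (for all $i,j\in\{1,\dots,n-1\}$): (1) $\sigma_i^2=e$; $\sigma_i\sigma_j=\sigma_j\sigma_i$ if $|i-j|>1$; $\sigma_i\sigma_j\sigma_i=\sigma_j\sigma_i\sigma_j$ if $|i-j|=1$; (2) $\tau_i^2=\tau_i$; $\tau_i\tau_j=\tau_j\tau_i$ if $i\ne j$; (3) $\tau_i\sigma_i=\sigma_i\tau_i=\tau_i$; $\tau_i\sigma_j=\sigma_j\tau_i$ if $|i-j|>1$; (4) $\sigma_i\tau_j\sigma_i=\sigma_j\tau_i\sigma_j$ and $\tau_i\sigma_j\tau_i=\tau_i\tau_j$ if $|i-j|=1$. Then the map $\sigma_i\mapsto s_i$, $\tau_i\mapsto\varrho_i$, $i=1,\dots,n-1$, extends to an isomorphism of monoids $\varphi:T\to\mathcal{IT}_n$.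
   Context: Let $M=\{1,\dots,n\}$ and let $M'=\{1',\dots,n'\}$ be a disjoint copy of $M$. The partition monoid $\mathfrak{C}_n$ is the set of all partitions (into nonempty blocks) of $M\cup M'$ with the following product. For $\alpha,\beta\in\mathfrak{C}_n$, identify each element $i'$ of $\alpha$ with the element $i$ of $\beta$ (a middle row $M''$), take the smallest equivalence relation on (left row $M$ of $\alpha$) $\cup M''\cup$ (right row $M'$ of $\beta$) containing both block relations, and restrict it to $M\cup M'$; the resulting partition is $\alpha\beta$ (components lying entirely in the middle row are discarded). The identity is the partition with blocks $\{j,j'\}$, $j\in M$. $\mathcal{IT}_n$ is the submonoid of $\mathfrak{C}_n$ of all partitions such that each block $X$ meets both $M$ and $M'$ and satisfies $|X\cap M|=|X\cap M'|$ (it is isomorphic to the greatest factorizable inverse submonoid of the dual symmetric inverse monoid on $M$). For $i=1,\dots,n-1$: $s_i\in\mathcal{IT}_n$ has blocks $\{i,(i+1)'\}$, $\{i+1,i'\}$ and $\{j,j'\}$ for $j\ne i,i+1$; $\varrho_i\in\mathcal{IT}_n$ has blocks $\{i,i+1,i',(i+1)'\}$ and $\{j,j'\}$ for $j\neq i,i+1$. *)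

theory Defs
  imports "HOL-Algebra.Group" "HOL-Library.Disjoint_Sets"
begin

text \<open>
  A point is a row together with a number: \<open>(Left_Row, i)\<close> is the element \<open>i\<close> of \<open>M\<close>,
  \<open>(Right_Row, i)\<close> is \<open>i'\<close>, and the middle row \<open>M''\<close> only occurs in the definition of the
  product.
\<close>

datatype row = Left_Row | Middle_Row | Right_Row

type_synonym point = "row \<times> nat"

definition left_points :: "nat \<Rightarrow> point set" where
  "left_points n = {Left_Row} \<times> {1..n}"

definition right_points :: "nat \<Rightarrow> point set" where
  "right_points n = {Right_Row} \<times> {1..n}"

definition points :: "nat \<Rightarrow> point set" where
  "points n = left_points n \<union> right_points n"

definition block_rel :: "'a set set \<Rightarrow> 'a \<Rightarrow> 'a \<Rightarrow> bool" where
  "block_rel P x y \<longleftrightarrow> (\<exists>X\<in>P. x \<in> X \<and> y \<in> X)"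

fun right_to_middle :: "point \<Rightarrow> point" where
  "right_to_middle (Left_Row, i) = (Left_Row, i)"
| "right_to_middle (Middle_Row, i) = (Middle_Row, i)"
| "right_to_middle (Right_Row, i) = (Middle_Row, i)"

fun left_to_middle :: "point \<Rightarrow> point" where
  "left_to_middle (Left_Row, i) = (Middle_Row, i)"
| "left_to_middle (Middle_Row, i) = (Middle_Row, i)"
| "left_to_middle (Right_Row, i) = (Right_Row, i)"

text \<open>
  The smallest equivalence relation (\<^const>\<open>equivclp\<close>) is formed on the whole type of points.
  Points outside the three rows of length \<open>n\<close> are related only to themselves, so this does
  not affect the restriction to \<^term>\<open>points n\<close>.
\<close>

definition product_rel :: "point set set \<Rightarrow> point set set \<Rightarrow> point \<Rightarrow> point \<Rightarrow> bool" where
  "product_rel \<alpha> \<beta> =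
     equivclp (block_rel (image right_to_middle ` \<alpha> \<union> image left_to_middle ` \<beta>))"

definition partition_mult ::
    "nat \<Rightarrow> point set set \<Rightarrow> point set set \<Rightarrow> point set set" where
  "partition_mult n \<alpha> \<beta> =
     points n // {(x, y). x \<in> points n \<and> y \<in> points n \<and> product_rel \<alpha> \<beta> x y}"

definition partition_one :: "nat \<Rightarrow> point set set" where
  "partition_one n = {{(Left_Row, j), (Right_Row, j)} | j. j \<in> {1..n}}"

definition partition_monoid :: "nat \<Rightarrow> point set set monoid" where
  "partition_monoid n =
     \<lparr>carrier = {P. partition_on (points n) P},
      mult = partition_mult n,
      one = partition_one n\<rparr>"

definition IT :: "nat \<Rightarrow> point set set monoid" where
  "IT n = (partition_monoid n)
     \<lparr>carrier := {P \<in> carrier (partition_monoid n).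
        \<forall>X\<in>P. X \<inter> left_points n \<noteq> {} \<and> X \<inter> right_points n \<noteq> {} \<and>
             card (X \<inter> left_points n) = card (X \<inter> right_points n)}\<rparr>"

definition s :: "nat \<Rightarrow> nat \<Rightarrow> point set set" where
  "s n i =
     {{(Left_Row, i), (Right_Row, i + 1)}, {(Left_Row, i + 1), (Right_Row, i)}} \<union>
     {{(Left_Row, j), (Right_Row, j)} | j. j \<in> {1..n} \<and> j \<noteq> i \<and> j \<noteq> i + 1}"

definition rho :: "nat \<Rightarrow> nat \<Rightarrow> point set set" where
  "rho n i =
     {{(Left_Row, i), (Left_Row, i + 1), (Right_Row, i), (Right_Row, i + 1)}} \<union>
     {{(Left_Row, j), (Right_Row, j)} | j. j \<in> {1..n} \<and> j \<noteq> i \<and> j \<noteq> i + 1}"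

text \<open>
  The smallest congruence, containing the pairs of words in \<open>R\<close>, on the free monoid of
  words over the alphabet \<open>A\<close>.
\<close>

inductive_set word_cong :: "'a set \<Rightarrow> ('a list \<times> 'a list) set \<Rightarrow> ('a list \<times> 'a list) set"
  for A :: "'a set" and R :: "('a list \<times> 'a list) set" where
  rel: "\<lbrakk>(u, v) \<in> R; u \<in> lists A; v \<in> lists A\<rbrakk> \<Longrightarrow> (u, v) \<in> word_cong A R"
| refl: "u \<in> lists A \<Longrightarrow> (u, u) \<in> word_cong A R"
| sym: "(u, v) \<in> word_cong A R \<Longrightarrow> (v, u) \<in> word_cong A R"
| trans: "\<lbrakk>(u, v) \<in> word_cong A R; (v, w) \<in> word_cong A R\<rbrakk> \<Longrightarrow> (u, w) \<in> word_cong A R"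
| append: "\<lbrakk>(u, v) \<in> word_cong A R; (u', v') \<in> word_cong A R\<rbrakk>
    \<Longrightarrow> (u @ u', v @ v') \<in> word_cong A R"

definition word_class :: "'a set \<Rightarrow> ('a list \<times> 'a list) set \<Rightarrow> 'a list \<Rightarrow> 'a list set" where
  "word_class A R w = word_cong A R `` {w}"

definition presented_monoid ::
    "'a set \<Rightarrow> ('a list \<times> 'a list) set \<Rightarrow> 'a list set monoid" where
  "presented_monoid A R =
     \<lparr>carrier = lists A // word_cong A R,
      mult = (\<lambda>X Y. \<Union>u\<in>X. \<Union>v\<in>Y. word_class A R (u @ v)),
      one = word_class A R []\<rparr>"

lemma word_cong_lists: "(u, v) \<in> word_cong A R \<Longrightarrow> u \<in> lists A \<and> v \<in> lists A"
  by (induction rule: word_cong.induct) auto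

lemma equiv_word_cong: "equiv (lists A) (word_cong A R)"
proof (rule equivI)
  show "word_cong A R \<subseteq> lists A \<times> lists A"
    using word_cong_lists by fast
  show "refl_on (lists A) (word_cong A R)"
    using word_cong_lists by (fastforce intro: refl_onI word_cong.refl)
  show "Relation.sym (word_cong A R)"
    by (rule symI) (rule word_cong.sym)
  show "Relation.trans (word_cong A R)"
    by (rule transI) (rule word_cong.trans)
qed

lemma carrier_presented_monoid:
  "carrier (presented_monoid A R) = word_class A R ` lists A"
  by (auto simp: presented_monoid_def quotient_def word_class_def)

lemma word_class_eq_iff:
  assumes "u \<in> lists A" "v \<in> lists A"
  shows "word_class A R u = word_class A R v \<longleftrightarrow> (u, v) \<in> word_cong A R"
  using eq_equiv_class_iff[OF equiv_word_cong assms] by (simp add: word_class_def)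

lemma mult_word_class:
  assumes "u \<in> lists A" "v \<in> lists A"
  shows "word_class A R u \<otimes>\<^bsub>presented_monoid A R\<^esub> word_class A R v = word_class A R (u @ v)"
proof -
  have eq: "word_class A R (u' @ v') = word_class A R (u @ v)"
    if "u' \<in> word_class A R u" "v' \<in> word_class A R v" for u' v'
  proof -
    have "(u, u') \<in> word_cong A R" "(v, v') \<in> word_cong A R"
      using that by (auto simp: word_class_def)
    then have c: "(u @ v, u' @ v') \<in> word_cong A R"
      by (rule word_cong.append)
    then show ?thesis
      using word_class_eq_iff word_cong_lists by metis
  qed
  have "u \<in> word_class A R u" "v \<in> word_class A R v"
    using assms by (auto simp: word_class_def intro: word_cong.refl)
  with eq show ?thesis
    unfolding presented_monoid_def monoid.simps by blast
qed

lemma monoid_presented_monoid: "monoid (presented_monoid A R)"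
proof -
  have one: "\<one>\<^bsub>presented_monoid A R\<^esub> = word_class A R []"
    by (simp add: presented_monoid_def)
  show ?thesis
  proof (rule monoidI, unfold carrier_presented_monoid one)
    show "word_class A R [] \<in> word_class A R ` lists A"
      by simp
  qed (elim imageE; simp only: mult_word_class append_in_lists_conv lists.Nil append_assoc
      append_Nil append_Nil2 imageI simp_thms)+
qed

datatype generator = \<sigma> nat | \<tau> nat

definition T_generators :: "nat \<Rightarrow> generator set" where
  "T_generators n = \<sigma> ` {1..<n} \<union> \<tau> ` {1..<n}"

definition T_relations :: "nat \<Rightarrow> (generator list \<times> generator list) set" where
  "T_relations n =
     {([\<sigma> i, \<sigma> i], []) | i. i \<in> {1..<n}} \<union>
     {([\<sigma> i, \<sigma> j], [\<sigma> j, \<sigma> i]) | i j.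
        i \<in> {1..<n} \<and> j \<in> {1..<n} \<and> \<bar>int i - int j\<bar> > 1} \<union>
     {([\<sigma> i, \<sigma> j, \<sigma> i], [\<sigma> j, \<sigma> i, \<sigma> j]) | i j.
        i \<in> {1..<n} \<and> j \<in> {1..<n} \<and> \<bar>int i - int j\<bar> = 1} \<union>
     {([\<tau> i, \<tau> i], [\<tau> i]) | i. i \<in> {1..<n}} \<union>
     {([\<tau> i, \<tau> j], [\<tau> j, \<tau> i]) | i j.
        i \<in> {1..<n} \<and> j \<in> {1..<n} \<and> i \<noteq> j} \<union>
     {([\<tau> i, \<sigma> i], [\<sigma> i, \<tau> i]) | i. i \<in> {1..<n}} \<union>
     {([\<sigma> i, \<tau> i], [\<tau> i]) | i. i \<in> {1..<n}} \<union>
     {([\<tau> i, \<sigma> j], [\<sigma> j, \<tau> i]) | i j.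
        i \<in> {1..<n} \<and> j \<in> {1..<n} \<and> \<bar>int i - int j\<bar> > 1} \<union>
     {([\<sigma> i, \<tau> j, \<sigma> i], [\<sigma> j, \<tau> i, \<sigma> j]) | i j.
        i \<in> {1..<n} \<and> j \<in> {1..<n} \<and> \<bar>int i - int j\<bar> = 1} \<union>
     {([\<tau> i, \<sigma> j, \<tau> i], [\<tau> i, \<tau> j]) | i j.
        i \<in> {1..<n} \<and> j \<in> {1..<n} \<and> \<bar>int i - int j\<bar> = 1}"

definition T :: "nat \<Rightarrow> generator list set monoid" where
  "T n = presented_monoid (T_generators n) (T_relations n)"

definition T_class :: "nat \<Rightarrow> generator \<Rightarrow> generator list set" where
  "T_class n g = word_class (T_generators n) (T_relations n) [g]"

end

theory Submission
  imports Defs "HOL-Combinatorics.Permutations"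
begin

text \<open>
  In every monoid satisfying the relations, a word in the \<open>\<sigma>\<^sub>i\<close> depends only on the permutation it
  represents (Coxeter presentation of the symmetric group, by the normal form
  \<open>w \<sigma>\<^sub>m \<dots> \<sigma>\<^sub>k\<close> with \<open>w\<close> in \<open>\<sigma>\<^sub>1, \<dots>, \<sigma>\<^bsub>m-1\<^esub>\<close>). Conjugating the \<open>\<tau>\<^sub>i\<close> yields idempotents
  \<open>e\<^bsub>ij\<^esub>\<close> that the \<open>\<sigma>\<^sub>k\<close> permute, that commute, and that satisfy
  \<open>e\<^bsub>ij\<^esub>e\<^bsub>jk\<^esub> = e\<^bsub>ij\<^esub>e\<^bsub>ik\<^esub>\<close> and \<open>e\<^bsub>ij\<^esub>(i j) = e\<^bsub>ij\<^esub>\<close>. Hence every word equals a product of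
  idempotents \<open>e\<^bsub>ij\<^esub>\<close> times a permutation; the product depends only on the equivalence relation
  generated by the pairs \<open>(i, j)\<close>, and it absorbs all permutations that preserve the classes.
  These data, an equivalence relation and a permutation modulo class-preserving ones, are exactly
  the data of an element of \<open>IT n\<close>.
\<close>

section \<open>Equivalences generated by pairs\<close>

text \<open>Taken on all of \<open>nat\<close>: if \<open>G\<close> lies in
  \<open>{1..n} \<times> {1..n}\<close>, the numbers outside are related only to themselves, so no
  carrier has to be carried along.\<close>

definition pair_equiv :: "(nat \<times> nat) set \<Rightarrow> nat \<Rightarrow> nat \<Rightarrow> bool" where
  "pair_equiv G = equivclp (\<lambda>x y. (x, y) \<in> G)"

lemma pair_equiv_refl [simp]: "pair_equiv G x x"
  by (simp add: pair_equiv_def)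

lemma pair_equiv_sym: "pair_equiv G x y \<Longrightarrow> pair_equiv G y x"
  unfolding pair_equiv_def by (rule equivclp_sym)

lemma pair_equiv_trans: "pair_equiv G x y \<Longrightarrow> pair_equiv G y z \<Longrightarrow> pair_equiv G x z"
  unfolding pair_equiv_def by (rule equivclp_trans)

lemma pair_equiv_base: "(x, y) \<in> G \<Longrightarrow> pair_equiv G x y"
  unfolding pair_equiv_def by (rule r_into_equivclp)

text \<open>In this symmetric form an induction amounts to checking that \<open>P\<close> is an
  equivalence containing \<open>G\<close>, instead of following a chain of steps.\<close>

lemma pair_equiv_induct [consumes 1, case_names base refl sym trans]:
  assumes "pair_equiv G x y"
    and base: "\<And>x y. (x, y) \<in> G \<Longrightarrow> P x y"
    and refl: "\<And>x. P x x"
    and sym: "\<And>x y. P x y \<Longrightarrow> P y x"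
    and trans: "\<And>x y z. P x y \<Longrightarrow> P y z \<Longrightarrow> P x z"
  shows "P x y"
  using assms(1) unfolding pair_equiv_def
  by (induction rule: equivclp_induct) (use base refl sym trans in blast)+

lemma pair_equiv_mono:
  assumes "\<And>x y. (x, y) \<in> G \<Longrightarrow> pair_equiv H x y" "pair_equiv G x y"
  shows "pair_equiv H x y"
  using assms(2)
  by (induction rule: pair_equiv_induct)
    (use assms(1) pair_equiv_sym pair_equiv_trans pair_equiv_refl in blast)+

lemma pair_equiv_outside:
  assumes "G \<subseteq> A \<times> A" "pair_equiv G x y"
  shows "x = y \<or> x \<in> A \<and> y \<in> A"
  using assms(2) by (induction rule: pair_equiv_induct) (use assms(1) in auto)

section \<open>The Coxeter presentation of the symmetric group\<close>

abbreviation adj_swap :: "nat \<Rightarrow> nat \<Rightarrow> nat" where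
  "adj_swap i \<equiv> transpose i (Suc i)"

definition swaps :: "nat list \<Rightarrow> nat \<Rightarrow> nat" where
  "swaps w = foldr (\<lambda>i f. adj_swap i \<circ> f) w id"

lemma swaps_simps [simp]:
  "swaps [] = id" "swaps (i # w) = adj_swap i \<circ> swaps w"
  by (simp_all add: swaps_def)

lemma swaps_append [simp]: "swaps (u @ v) = swaps u \<circ> swaps v"
  by (induction u) (simp_all add: comp_assoc)

lemma swaps_permutes:
  assumes "set w \<subseteq> {1..<n}"
  shows "swaps w permutes {1..n}"
  using assms
proof (induction w)
  case Nil
  show ?case using permutes_id[of "{1..n}"] by (simp add: id_def)
next
  case (Cons i w)
  then have "adj_swap i permutes {1..n}" by (intro permutes_swap_id) auto
  with Cons show ?case by (metis insert_subset list.simps(15) permutes_compose swaps_simps(2))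
qed

lemma swaps_rev_comp: "swaps (rev w) \<circ> swaps w = id"
proof (induction w)
  case (Cons i w)
  have "swaps (rev (i # w)) \<circ> swaps (i # w)
      = swaps (rev w) \<circ> (adj_swap i \<circ> adj_swap i) \<circ> swaps w"
    by (simp only: swaps_append swaps_simps rev.simps comp_assoc comp_id)
  then show ?case using Cons by simp
qed simp

lemma swaps_comp_rev: "swaps w \<circ> swaps (rev w) = id"
  using swaps_rev_comp[of "rev w"] by simp

text \<open>The rightmost letter acts first, so the word \<open>m-1, ..., k\<close> carries
  \<open>k\<close> upwards one place at a time.\<close>

lemma swaps_descending: "k \<le> m \<Longrightarrow> swaps (rev [k..<m]) k = m"
proof (induction m rule: dec_induct)
  case (step j)
  then show ?case by (simp add: transpose_def)
qed simp

text \<open>Induction on \<open>n\<close>: composing \<open>p\<close> on the right with the inverse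
  of the descending word that starts at the preimage \<open>k\<close> of the top point gives a
  permutation fixing the top point.\<close>

lemma permutes_eq_swaps:
  assumes "p permutes {1..n}"
  obtains w where "set w \<subseteq> {1..<n}" "swaps w = p"
proof -
  have "\<exists>w. set w \<subseteq> {1..<n} \<and> swaps w = p"
    using assms
  proof (induction n arbitrary: p)
    case 0
    then show ?case by (auto intro!: exI[of _ "[]"])
  next
    case (Suc m)
    obtain k where pk: "p k = Suc m"
      using permutes_surj[OF Suc.prems] by (metis surjD)
    have k: "k \<in> {1..Suc m}"
      using permutes_in_image[OF Suc.prems, of k] pk by simp
    let ?d = "rev [k..<Suc m]"
    have d: "set ?d \<subseteq> {1..<Suc m}" "set (rev ?d) \<subseteq> {1..<Suc m}" using k by auto
    have q: "p \<circ> swaps (rev ?d) permutes {1..Suc m}"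
      by (rule permutes_compose[OF swaps_permutes[OF d(2)] Suc.prems])
    have "swaps (rev ?d) (Suc m) = swaps (rev ?d) (swaps ?d k)"
      using k swaps_descending[of k "Suc m"] by (simp del: upt_Suc)
    also have "\<dots> = k"
      using swaps_rev_comp[of ?d] by (metis comp_apply id_apply)
    finally have "(p \<circ> swaps (rev ?d)) (Suc m) = Suc m"
      using pk by simp
    then have "p \<circ> swaps (rev ?d) permutes {1..m}"
      using permutes_superset[OF q, of "{1..m}"]
      by (metis Diff_iff atLeastAtMost_iff le_SucE)
    with Suc.IH obtain w where w: "set w \<subseteq> {1..<m}" "swaps w = p \<circ> swaps (rev ?d)"
      by blast
    have "swaps (w @ ?d) = p"
      by (simp only: swaps_append w comp_assoc swaps_rev_comp comp_id)
    moreover have "set (w @ ?d) \<subseteq> {1..<Suc m}" using w d by auto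
    ultimately show ?case by blast
  qed
  then show ?thesis using that by blast
qed

text \<open>In the finite set \<open>B\<close> the complements of \<open>A\<close> and of its image
  have the same size, so any bijection between them completes \<open>f\<close>.\<close>

lemma permutes_extending:
  assumes "finite B" "A \<subseteq> B" "inj_on f A" "f ` A \<subseteq> B"
  obtains p where "p permutes B" "\<And>x. x \<in> A \<Longrightarrow> p x = f x"
proof -
  have "finite A" using assms finite_subset by blast
  then have "card (B - A) = card (B - f ` A)"
    using assms by (simp add: card_Diff_subset card_image)
  then obtain g where g: "bij_betw g (B - A) (B - f ` A)"
    using assms(1) finite_same_card_bij[of "B - A" "B - f ` A"] by auto
  define p where "p x = (if x \<in> A then f x else if x \<in> B then g x else x)" for x
  have "bij_betw p A (f ` A)"
    using assms(3) by (simp add: p_def bij_betw_def inj_on_def)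
  moreover have "bij_betw p (B - A) (B - f ` A)"
    using g by (subst bij_betw_cong[where g = g]) (auto simp: p_def)
  ultimately have "bij_betw p (A \<union> (B - A)) (f ` A \<union> (B - f ` A))"
    by (rule bij_betw_combine) auto
  then have "bij_betw p B B" using assms by (simp add: Un_absorb1)
  then have "p permutes B"
    using assms(2) by (intro bij_imp_permutes) (auto simp: p_def)
  then show ?thesis using that by (simp add: p_def)
qed

section \<open>Normal forms in a monoid satisfying the Coxeter relations\<close>

locale symmetric_presentation =
  fixes n :: nat and sg :: "nat \<Rightarrow> 'a::monoid_mult"
  assumes sg_sq: "\<lbrakk>1 \<le> i; i < n\<rbrakk> \<Longrightarrow> sg i * sg i = 1"
    and sg_comm: "\<lbrakk>1 \<le> i; Suc i < j; j < n\<rbrakk> \<Longrightarrow> sg i * sg j = sg j * sg i"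
    and sg_braid: "\<lbrakk>1 \<le> i; Suc i < n\<rbrakk> \<Longrightarrow> sg i * sg (Suc i) * sg i = sg (Suc i) * sg i * sg (Suc i)"
begin

definition prodS :: "nat list \<Rightarrow> 'a" where
  "prodS w = prod_list (map sg w)"

lemma prodS_simps [simp]:
  "prodS [] = 1" "prodS (i # w) = sg i * prodS w" "prodS (u @ v) = prodS u * prodS v"
  by (simp_all add: prodS_def)

lemma prodS_rev_inverse:
  assumes "set w \<subseteq> {1..<n}"
  shows "prodS (rev w) * prodS w = 1"
  using assms
proof (induction w)
  case (Cons i w)
  have "prodS (rev (i # w)) * prodS (i # w) = prodS (rev w) * (sg i * sg i) * prodS w"
    by (simp add: mult.assoc)
  then show ?case using Cons by (simp add: sg_sq)
qed simp

text \<open>Stands in for the congruence generated by the Coxeter relations: each rewriting step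
  keeps both the value in the monoid and the permutation, so a normal form retains both.\<close>

definition same :: "nat list \<Rightarrow> nat list \<Rightarrow> bool" where
  "same u v \<longleftrightarrow> prodS u = prodS v \<and> swaps u = swaps v"

lemma same_refl [simp]: "same u u"
  and same_sym: "same u v \<Longrightarrow> same v u"
  and same_trans [trans]: "same u v \<Longrightarrow> same v w \<Longrightarrow> same u w"
  and same_append: "same u v \<Longrightarrow> same u' v' \<Longrightarrow> same (u @ u') (v @ v')"
  by (simp_all add: same_def)

lemma same_comm: "\<lbrakk>1 \<le> i; Suc i < j; j < n\<rbrakk> \<Longrightarrow> same [i, j] [j, i]"
  using sg_comm[of i j] by (auto simp: same_def transpose_def fun_eq_iff)

lemma same_sq: "\<lbrakk>1 \<le> i; i < n\<rbrakk> \<Longrightarrow> same [i, i] []"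
  by (simp add: same_def sg_sq)

lemma same_braid: "\<lbrakk>1 \<le> i; Suc i < n\<rbrakk> \<Longrightarrow> same [Suc i, i, Suc i] [i, Suc i, i]"
  using sg_braid[of i] by (auto simp: same_def mult.assoc transpose_def fun_eq_iff)

lemma same_comm_list:
  assumes "\<And>i. i \<in> set w \<Longrightarrow> same [i, j] [j, i]"
  shows "same (w @ [j]) (j # w)"
  using assms
proof (induction w)
  case (Cons i w)
  have "same ([i] @ (w @ [j])) ([i] @ (j # w))"
    using Cons by (intro same_append) auto
  moreover have "same ([i, j] @ w) ([j, i] @ w)"
    using Cons by (intro same_append) auto
  ultimately show ?case using same_trans by simp
qed simp

lemma descending_split: "\<lbrakk>k \<le> j; j \<le> m\<rbrakk> \<Longrightarrow> rev [k..<m] = rev [j..<m] @ rev [k..<j]"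
  by (metis le_add_diff_inverse rev_append upt_add_eq_append)

text \<open>A letter well below the descending run passes through it, one just below lengthens it,
  the last letter of the run cancels, and a letter \<open>j > k\<close> re-emerges on the left as
  \<open>j - 1\<close> by a braid relation.\<close>

lemma descending_mult:
  assumes "1 \<le> k" "k \<le> Suc m" "1 \<le> j" "j \<le> m" "m < n"
  obtains w l where "set w \<subseteq> {1..<m}" "1 \<le> l" "l \<le> Suc m"
    "same (rev [k..<Suc m] @ [j]) (w @ rev [l..<Suc m])"
proof -
  consider "Suc j < k" | "Suc j = k" | "j = k" | "k < j" by linarith
  then show ?thesis
  proof cases
    case 1
    have "same (rev [k..<Suc m] @ [j]) (j # rev [k..<Suc m])"
      by (rule same_comm_list, rule same_sym, rule same_comm) (use 1 assms in auto)
    then show ?thesis using that[of "[j]" k] 1 assms by simp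
  next
    case 2
    then have "rev [k..<Suc m] @ [j] = [] @ rev [j..<Suc m]"
      using assms by (simp add: upt_conv_Cons del: upt_Suc)
    then show ?thesis using that[of "[]" j] 2 assms by (metis same_refl empty_set empty_subsetI le_SucI)
  next
    case 3
    then have "rev [k..<Suc m] @ [j] = rev [Suc k..<Suc m] @ [k, k]"
      using assms by (simp add: upt_conv_Cons del: upt_Suc)
    moreover have "same (rev [Suc k..<Suc m] @ [k, k]) (rev [Suc k..<Suc m] @ [])"
      using 3 assms by (intro same_append same_sq) auto
    ultimately show ?thesis using that[of "[]" "Suc k"] 3 assms by (simp del: upt_Suc)
  next
    case 4
    \<comment> \<open>The trailing \<open>Suc i\<close> moves left up to \<open>Suc i, i\<close>;
      the braid relation turns the three letters into \<open>i, Suc i, i\<close>; the first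
      \<open>i\<close> then passes the larger letters in \<open>?A\<close> to the front.\<close>
    define i where "i = j - 1"
    have i: "j = Suc i" "k \<le> i" using 4 by (auto simp: i_def)
    let ?A = "rev [Suc (Suc i)..<Suc m]" and ?B = "rev [k..<i]"
    have split: "rev [k..<Suc m] = ?A @ [Suc i, i] @ ?B"
      using descending_split[of k "Suc (Suc i)" "Suc m"] i assms by simp
    have "same (?A @ [Suc i, i] @ (?B @ [Suc i])) (?A @ [Suc i, i] @ (Suc i # ?B))"
      by (intro same_append same_refl same_comm_list same_comm) (use i assms in auto)
    also have "?A @ [Suc i, i] @ (Suc i # ?B) = ?A @ [Suc i, i, Suc i] @ ?B" by simp
    also have "same (?A @ [Suc i, i, Suc i] @ ?B) (?A @ [i, Suc i, i] @ ?B)"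
      by (intro same_append same_refl same_braid) (use i assms in auto)
    also have "?A @ [i, Suc i, i] @ ?B = (?A @ [i]) @ [Suc i, i] @ ?B" by simp
    also have "same ((?A @ [i]) @ [Suc i, i] @ ?B) ((i # ?A) @ [Suc i, i] @ ?B)"
      by (intro same_append same_refl same_comm_list same_sym[OF same_comm]) (use i assms in auto)
    finally have "same (rev [k..<Suc m] @ [j]) ([i] @ rev [k..<Suc m])"
      using split i by simp
    then show ?thesis using that[of "[i]" k] i assms by simp
  qed
qed

lemma normal_form:
  assumes "set w \<subseteq> {1..<Suc m}" "m < n"
  obtains w' k where "set w' \<subseteq> {1..<m}" "1 \<le> k" "k \<le> Suc m" "same w (w' @ rev [k..<Suc m])"
proof -
  have "\<exists>w' k. set w' \<subseteq> {1..<m} \<and> 1 \<le> k \<and> k \<le> Suc m \<and> same w (w' @ rev [k..<Suc m])"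
    using assms
  proof (induction w rule: rev_induct)
    case Nil
    then show ?case by (intro exI[of _ "[]"] exI[of _ "Suc m"]) simp
  next
    case (snoc j w)
    then obtain w' k where w: "set w' \<subseteq> {1..<m}" "1 \<le> k" "k \<le> Suc m"
      "same w (w' @ rev [k..<Suc m])" by auto
    obtain v l where v: "set v \<subseteq> {1..<m}" "1 \<le> l" "l \<le> Suc m"
      "same (rev [k..<Suc m] @ [j]) (v @ rev [l..<Suc m])"
      using descending_mult[of k m j] w snoc.prems by auto
    have "same (w @ [j]) ((w' @ rev [k..<Suc m]) @ [j])"
      by (intro same_append w same_refl)
    also have "(w' @ rev [k..<Suc m]) @ [j] = w' @ (rev [k..<Suc m] @ [j])" by simp
    also have "same (w' @ (rev [k..<Suc m] @ [j])) (w' @ (v @ rev [l..<Suc m]))"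
      by (intro same_append v same_refl)
    finally show ?case using w v by (intro exI[of _ "w' @ v"] exI[of _ l]) simp
  qed
  then show ?thesis using that by blast
qed

text \<open>The normal form is determined by the permutation: its run starts at the preimage of the
  top point, and what precedes the run is a word in fewer letters, to which induction
  applies.\<close>

theorem prodS_eq_if_swaps_eq:
  assumes "set u \<subseteq> {1..<n}" "set v \<subseteq> {1..<n}" "swaps u = swaps v"
  shows "prodS u = prodS v"
proof -
  \<comment> \<open>The alphabet shrinks with \<open>m\<close>, while the relations stay those for
    \<open>n\<close>.\<close>
  have "prodS u = prodS v"
    if "set u \<subseteq> {1..<m}" "set v \<subseteq> {1..<m}" "swaps u = swaps v" "m \<le> n" for m u v
    using that
  proof (induction m arbitrary: u v)
    case (Suc m)
    obtain u' k where u: "set u' \<subseteq> {1..<m}" "1 \<le> k" "k \<le> Suc m" "same u (u' @ rev [k..<Suc m])"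
      using normal_form[OF Suc.prems(1)] Suc.prems by auto
    obtain v' l where v: "set v' \<subseteq> {1..<m}" "1 \<le> l" "l \<le> Suc m" "same v (v' @ rev [l..<Suc m])"
      using normal_form[OF Suc.prems(2)] Suc.prems by auto
    have top: "swaps w (Suc m) = Suc m" if "set w \<subseteq> {1..<m}" for w
      using swaps_permutes[OF that] by (simp add: permutes_def)
    have "swaps u k = Suc m"
      using u top[OF u(1)] swaps_descending[of k "Suc m"] by (simp add: same_def del: upt_Suc)
    moreover have "swaps v l = Suc m"
      using v top[OF v(1)] swaps_descending[of l "Suc m"] by (simp add: same_def del: upt_Suc)
    moreover have "inj (swaps v)"
      using swaps_permutes[OF Suc.prems(2)] by (rule permutes_inj)
    ultimately have kl: "k = l" using Suc.prems(3) by (metis injD)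
    let ?d = "rev [k..<Suc m]"
    \<comment> \<open>Appending the reversed run cancels \<open>?d\<close> on both sides, which
      leaves the permutations of \<open>u'\<close> and \<open>v'\<close>.\<close>
    have "swaps (u' @ ?d @ rev ?d) = swaps (v' @ ?d @ rev ?d)"
      using u(4) v(4) Suc.prems(3) unfolding kl same_def swaps_append by (metis comp_assoc)
    then have "swaps u' = swaps v'"
      using swaps_rev_comp[of "rev ?d"] by simp
    then have "prodS u' = prodS v'"
      by (intro Suc.IH u v) (use Suc.prems in auto)
    then show ?case using u(4) v(4) kl by (simp add: same_def del: upt_Suc)
  qed simp
  from this[OF assms] show ?thesis by simp
qed

end

section \<open>Merging idempotents\<close>

declare One_nat_def [simp del]

text \<open>Provides the conjugating words that reduce identities at arbitrary indices to the first
  few indices. Points count from 1 and list positions from 0, hence the shift.\<close>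

lemma word_moving:
  assumes "distinct xs" "set xs \<subseteq> {1..n}"
  obtains w where "set w \<subseteq> {1..<n}" "\<And>i. i < length xs \<Longrightarrow> swaps w (Suc i) = xs ! i"
proof -
  have len: "length xs \<le> n"
    using assms card_mono[of "{1..n}" "set xs"] by (simp add: distinct_card)
  have inj: "inj_on (\<lambda>i. xs ! (i - 1)) {1..length xs}"
    using assms(1) by (auto simp: inj_on_def nth_eq_iff_index_eq)
  have im: "(\<lambda>i. xs ! (i - 1)) ` {1..length xs} \<subseteq> {1..n}"
  proof (rule image_subsetI)
    fix i assume "i \<in> {1..length xs}"
    then have "xs ! (i - 1) \<in> set xs" by (intro nth_mem) auto
    then show "xs ! (i - 1) \<in> {1..n}" using assms(2) by blast
  qed
  obtain p where p: "p permutes {1..n}" "\<And>x. x \<in> {1..length xs} \<Longrightarrow> p x = xs ! (x - 1)"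
    using permutes_extending[OF _ _ inj im] len by auto
  obtain w where "set w \<subseteq> {1..<n}" "swaps w = p"
    using permutes_eq_swaps[OF p(1)] .
  then show ?thesis using that p(2) by auto
qed

lemma word_moving2:
  assumes "i \<in> {1..n}" "j \<in> {1..n}" "i \<noteq> j"
  obtains w where "set w \<subseteq> {1..<n}" "swaps w 1 = i" "swaps w 2 = j"
proof -
  obtain w where w: "set w \<subseteq> {1..<n}" "\<And>m. m < length [i, j] \<Longrightarrow> swaps w (Suc m) = [i, j] ! m"
    using word_moving[of "[i, j]"] assms by auto
  from that[OF w(1)] w(2)[of 0] w(2)[of 1] show ?thesis by (simp add: numeral_2_eq_2 One_nat_def)
qed

lemma word_moving3:
  assumes "i \<in> {1..n}" "j \<in> {1..n}" "k \<in> {1..n}" "i \<noteq> j" "i \<noteq> k" "j \<noteq> k"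
  obtains w where "set w \<subseteq> {1..<n}" "swaps w 1 = i" "swaps w 2 = j" "swaps w 3 = k" "3 \<le> n"
proof -
  have "card {i, j, k} \<le> card {1..n}" using assms by (intro card_mono) auto
  then have "3 \<le> n" using assms by simp
  obtain w where w: "set w \<subseteq> {1..<n}"
    "\<And>m. m < length [i, j, k] \<Longrightarrow> swaps w (Suc m) = [i, j, k] ! m"
    using word_moving[of "[i, j, k]"] assms by auto
  from that[OF w(1)] w(2)[of 0] w(2)[of 1] w(2)[of 2] \<open>3 \<le> n\<close> show ?thesis
    by (simp add: numeral_2_eq_2 numeral_3_eq_3 One_nat_def)
qed

lemma word_moving4:
  assumes "i \<in> {1..n}" "j \<in> {1..n}" "k \<in> {1..n}" "l \<in> {1..n}" "distinct [i, j, k, l]"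
  obtains w where "set w \<subseteq> {1..<n}" "swaps w 1 = i" "swaps w 2 = j" "swaps w 3 = k"
    "swaps w 4 = l" "4 \<le> n"
proof -
  have "card {i, j, k, l} \<le> card {1..n}" using assms by (intro card_mono) auto
  then have "4 \<le> n" using assms by simp
  obtain w where w: "set w \<subseteq> {1..<n}"
    "\<And>m. m < length [i, j, k, l] \<Longrightarrow> swaps w (Suc m) = [i, j, k, l] ! m"
    using word_moving[of "[i, j, k, l]"] assms by auto
  from that[OF w(1)] w(2)[of 0] w(2)[of 1] w(2)[of 2] w(2)[of 3] \<open>4 \<le> n\<close> show ?thesis
    by (simp add: eval_nat_numeral One_nat_def)
qed

section \<open>The conjugates of the \<open>tg\<close> and the action of the \<open>sg\<close> on
  them\<close>

locale factorizable_presentation = symmetric_presentation n sg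
  for n :: nat and sg :: "nat \<Rightarrow> 'a::monoid_mult" +
  fixes tg :: "nat \<Rightarrow> 'a"
  assumes tg_idem: "\<lbrakk>1 \<le> i; i < n\<rbrakk> \<Longrightarrow> tg i * tg i = tg i"
    and tg_comm: "\<lbrakk>1 \<le> i; i < j; j < n\<rbrakk> \<Longrightarrow> tg i * tg j = tg j * tg i"
    and tg_sg: "\<lbrakk>1 \<le> i; i < n\<rbrakk> \<Longrightarrow> tg i * sg i = tg i"
    and sg_tg: "\<lbrakk>1 \<le> i; i < n\<rbrakk> \<Longrightarrow> sg i * tg i = tg i"
    and sg_tg_comm:
      "\<lbrakk>1 \<le> i; i < n; 1 \<le> j; j < n; Suc i < j \<or> Suc j < i\<rbrakk> \<Longrightarrow> sg i * tg j = tg j * sg i"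
    and sg_tg_sg:
      "\<lbrakk>1 \<le> i; Suc i < n\<rbrakk> \<Longrightarrow> sg i * tg (Suc i) * sg i = sg (Suc i) * tg i * sg (Suc i)"
    and tg_sg_tg: "\<lbrakk>1 \<le> i; Suc i < n\<rbrakk> \<Longrightarrow> tg i * sg (Suc i) * tg i = tg i * tg (Suc i)"
begin

text \<open>For \<open>i < j\<close> this is \<open>tg i\<close> conjugated by
  \<open>sg (i+1)\<close>, ..., \<open>sg (j-1)\<close> in turn; the values for
  \<open>j \<le> i\<close> are placeholders.\<close>

primrec merge_lt :: "nat \<Rightarrow> nat \<Rightarrow> 'a" where
  "merge_lt i 0 = 1"
| "merge_lt i (Suc j) = (if j = i then tg i else sg j * merge_lt i j * sg j)"

definition merge :: "nat \<Rightarrow> nat \<Rightarrow> 'a" where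
  "merge i j = (if i = j then 1 else merge_lt (min i j) (max i j))"

lemma sg_sq': "\<lbrakk>1 \<le> i; i < n\<rbrakk> \<Longrightarrow> sg i * (sg i * x) = x"
  using sg_sq[of i] by (simp flip: mult.assoc)

lemma sg_comm_far: "\<lbrakk>1 \<le> i; i < n; 1 \<le> j; j < n; Suc i < j \<or> Suc j < i\<rbrakk> \<Longrightarrow> sg i * sg j = sg j * sg i"
  using sg_comm[of i j] sg_comm[of j i] by metis

text \<open>Serves as the induction step for growing upper index: the next conjugator
  \<open>b\<close> commutes with \<open>a\<close>, so the exchange of \<open>x\<close> for
  \<open>y\<close> survives conjugation.\<close>

lemma commute_conj:
  fixes a b x :: 'a
  assumes "a * b = b * a" "a * x = y * a"
  shows "a * (b * x * b) = b * y * b * a"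
proof -
  have "a * (b * x * b) = (a * b) * x * b" by (simp only: mult.assoc)
  also have "\<dots> = b * (a * x) * b" by (simp only: assms(1) mult.assoc)
  also have "\<dots> = b * y * (a * b)" by (simp only: assms(2)) (simp only: mult.assoc)
  also have "\<dots> = b * y * b * a" by (simp only: assms(1) mult.assoc)
  finally show ?thesis .
qed

lemma sg_merge_lt_far:
  assumes "1 \<le> k" "k < n" "1 \<le> i" "i < j" "j \<le> n" "j < k \<or> Suc k < i"
  shows "sg k * merge_lt i j = merge_lt i j * sg k"
  using assms(4,5,6)
proof (induction j)
  case (Suc j)
  show ?case
  proof (cases "j = i")
    case True
    then show ?thesis using assms(1-3) Suc.prems by (auto intro!: sg_tg_comm)
  next
    case False
    then have "sg k * merge_lt i j = merge_lt i j * sg k" "sg k * sg j = sg j * sg k"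
      using assms Suc by (auto intro: sg_comm_far)
    from commute_conj[OF this(2,1)] show ?thesis using False by simp
  qed
qed simp

lemma sg_merge_lt_top:
  assumes "1 \<le> i" "i < j" "j < n"
  shows "sg j * merge_lt i j = merge_lt i (Suc j) * sg j"
  using assms by (simp add: mult.assoc sg_sq)

lemma sg_merge_lt_below_top:
  assumes "1 \<le> i" "i < j" "j < n"
  shows "sg j * merge_lt i (Suc j) = merge_lt i j * sg j"
  using assms by (simp add: mult.assoc sg_sq')

text \<open>The critical case is the outermost conjugator \<open>sg (Suc k)\<close>: the braid
  relation is used on the left and again on the right of \<open>merge_lt i k\<close>, which commutes
  with \<open>sg (Suc k)\<close>. Larger \<open>j\<close> follow by
  \<open>commute_conj\<close>.\<close>

lemma sg_merge_lt_between:
  assumes "1 \<le> i" "i < k" "Suc k < j" "j \<le> n"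
  shows "sg k * merge_lt i j = merge_lt i j * sg k"
  using assms(3,4)
proof (induction j)
  case (Suc j)
  show ?case
  proof (cases "j = Suc k")
    case True
    let ?x = "merge_lt i k"
    have braid: "sg k * (sg (Suc k) * (sg k * y)) = sg (Suc k) * (sg k * (sg (Suc k) * y))" for y
    proof -
      have "sg k * sg (Suc k) * sg k * y = sg (Suc k) * sg k * sg (Suc k) * y"
        using sg_braid[of k] assms(1,2) Suc.prems True by simp
      then show ?thesis by (simp only: mult.assoc)
    qed
    have far: "sg (Suc k) * (?x * y) = ?x * (sg (Suc k) * y)" for y
      using sg_merge_lt_far[of "Suc k" i k] assms Suc.prems by (simp flip: mult.assoc)
    have "sg k * (sg (Suc k) * (sg k * (?x * (sg k * sg (Suc k)))))
        = sg (Suc k) * (sg k * (?x * (sg (Suc k) * (sg k * sg (Suc k)))))"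
      by (simp only: braid far)
    also have "sg (Suc k) * (sg k * sg (Suc k)) = sg k * (sg (Suc k) * sg k)"
      using sg_braid[of k] assms Suc.prems True by (simp add: mult.assoc)
    finally show ?thesis using True assms by (simp add: mult.assoc)
  next
    case False
    then have "sg k * merge_lt i j = merge_lt i j * sg k" "sg k * sg j = sg j * sg k"
      using assms Suc by (auto intro: sg_comm_far)
    from commute_conj[OF this(2,1)] show ?thesis using False assms Suc.prems by simp
  qed
qed simp

text \<open>At the least upper index \<open>k + 2\<close> this is \<open>sg_tg_sg\<close> with one
  factor \<open>sg k\<close> brought to the other side; all further conjugators commute with
  \<open>sg k\<close>.\<close>

lemma sg_merge_lt_pred:
  assumes "1 \<le> k" "Suc k < j" "j \<le> n"
  shows "sg k * merge_lt (Suc k) j = merge_lt k j * sg k"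
  using assms(2,3)
proof (induction j)
  case (Suc j)
  show ?case
  proof (cases "j = Suc k")
    case True
    have "sg k * tg (Suc k) = sg k * tg (Suc k) * sg k * sg k"
      using assms Suc.prems True by (simp add: mult.assoc sg_sq)
    also have "\<dots> = sg (Suc k) * tg k * sg (Suc k) * sg k"
      using assms Suc.prems True sg_tg_sg[of k] by simp
    finally show ?thesis using True by simp
  next
    case False
    then have "sg k * merge_lt (Suc k) j = merge_lt k j * sg k" "sg k * sg j = sg j * sg k"
      using assms Suc by (auto intro: sg_comm_far)
    from commute_conj[OF this(2,1)] show ?thesis using False assms Suc.prems by simp
  qed
qed simp

lemma sg_merge_lt_bottom:
  assumes "1 \<le> k" "Suc k < j" "j \<le> n"
  shows "sg k * merge_lt k j = merge_lt (Suc k) j * sg k"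
proof -
  have "sg k * merge_lt k j = sg k * (merge_lt k j * sg k) * sg k"
    using assms by (simp add: mult.assoc sg_sq)
  also have "\<dots> = merge_lt (Suc k) j * sg k"
    using assms by (simp add: sg_sq' flip: sg_merge_lt_pred[OF assms])
  finally show ?thesis .
qed

lemma merge_sym: "merge i j = merge j i"
  by (simp add: merge_def min.commute max.commute)

lemma merge_refl [simp]: "merge i i = 1"
  by (simp add: merge_def)

lemma merge_Suc: "merge i (Suc i) = tg i"
  by (simp add: merge_def)

text \<open>The seven cases are the positions of \<open>k\<close> and \<open>k + 1\<close> relative
  to \<open>i < j\<close>. They show that the \<open>sg\<close> act on the idempotents by permuting
  indices.\<close>

lemma sg_merge:
  assumes "1 \<le> k" "k < n" "i \<in> {1..n}" "j \<in> {1..n}"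
  shows "sg k * merge i j = merge (adj_swap k i) (adj_swap k j) * sg k"
proof -
  have *: "sg k * merge i j = merge (adj_swap k i) (adj_swap k j) * sg k"
    if ij: "1 \<le> i" "i < j" "j \<le> n" for i j
  proof -
    consider "j < k \<or> Suc k < i" | "k = j" | "j = Suc k" "i = k" | "j = Suc k" "i < k"
      | "i < k" "Suc k < j" | "k = i" "Suc k < j" | "i = Suc k"
      using ij by linarith
    then show ?thesis
    proof cases
      case 1
      then show ?thesis using sg_merge_lt_far[of k i j] assms ij
        by (auto simp: merge_def transpose_def)
    next
      case 2
      then show ?thesis using sg_merge_lt_top[of i j] assms ij
        by (auto simp: merge_def transpose_def)
    next
      case 3
      then show ?thesis using assms by (simp add: merge_def sg_tg tg_sg)
    next
      case 4
      then show ?thesis using sg_merge_lt_below_top[of i k] assms ij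
        by (auto simp: merge_def transpose_def)
    next
      case 5
      then show ?thesis using sg_merge_lt_between[of i k j] assms ij
        by (auto simp: merge_def transpose_def)
    next
      case 6
      then show ?thesis using sg_merge_lt_bottom[of k j] assms ij
        by (auto simp: merge_def transpose_def)
    next
      case 7
      then show ?thesis using sg_merge_lt_pred[of k j] assms ij
        by (auto simp: merge_def transpose_def)
    qed
  qed
  consider "i < j" | "i = j" | "j < i" by linarith
  then show ?thesis
  proof cases
    case 1
    then show ?thesis using * assms by simp
  next
    case 3
    then show ?thesis using *[of j i] assms merge_sym by simp
  qed simp
qed

lemma prodS_merge:
  assumes "set w \<subseteq> {1..<n}" "i \<in> {1..n}" "j \<in> {1..n}"
  shows "prodS w * merge i j = merge (swaps w i) (swaps w j) * prodS w"
  using assms(1)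
proof (induction w)
  case (Cons k w)
  then have w: "swaps w permutes {1..n}" by (intro swaps_permutes) simp
  have "sg k * merge (swaps w i) (swaps w j)
      = merge (adj_swap k (swaps w i)) (adj_swap k (swaps w j)) * sg k"
    using Cons.prems permutes_in_image[OF w] assms(2,3) by (intro sg_merge) auto
  with Cons show ?case by (simp add: mult.assoc) (metis mult.assoc)
qed simp

lemma prodS_inverse_rev: "set w \<subseteq> {1..<n} \<Longrightarrow> prodS w * prodS (rev w) = 1"
  using prodS_rev_inverse[of "rev w"] by simp

lemma merge_swaps:
  assumes "set w \<subseteq> {1..<n}" "i \<in> {1..n}" "j \<in> {1..n}"
  shows "merge (swaps w i) (swaps w j) = prodS w * merge i j * prodS (rev w)"
  using prodS_merge[OF assms] prodS_inverse_rev[OF assms(1)] by (simp add: mult.assoc)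

text \<open>The inner factors \<open>prodS (rev w) * prodS w\<close> cancel, so a product of two
  idempotents is conjugated as a whole.\<close>

lemma merge_mult_swaps:
  assumes "set w \<subseteq> {1..<n}" "i \<in> {1..n}" "j \<in> {1..n}" "k \<in> {1..n}" "l \<in> {1..n}"
  shows "merge (swaps w i) (swaps w j) * merge (swaps w k) (swaps w l)
    = prodS w * (merge i j * merge k l) * prodS (rev w)"
proof -
  have "prodS (rev w) * (prodS w * x) = x" for x
    using prodS_rev_inverse[OF assms(1)] by (simp flip: mult.assoc)
  then show ?thesis by (simp add: merge_swaps[OF assms(1-3)] merge_swaps[OF assms(1,4,5)] mult.assoc)
qed

text \<open>Every identity below between the \<open>merge i j\<close> is conjugate to one between the generators \<open>tg 1\<close>,
  \<open>tg 2\<close>, \<open>tg 3\<close>.\<close>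

lemma merge_12: "merge 1 2 = tg 1" and merge_23: "merge 2 3 = tg 2" and merge_34: "merge 3 4 = tg 3"
  using merge_Suc[of 1] merge_Suc[of 2] merge_Suc[of 3] by simp_all

lemma merge_idem:
  assumes "i \<in> {1..n}" "j \<in> {1..n}"
  shows "merge i j * merge i j = merge i j"
proof (cases "i = j")
  case False
  then have n: "2 \<le> n" using assms by auto
  obtain w where w: "set w \<subseteq> {1..<n}" "swaps w 1 = i" "swaps w 2 = j"
    using word_moving2 assms False by metis
  show ?thesis
    using merge_mult_swaps[OF w(1), of 1 2 1 2] merge_swaps[OF w(1), of 1 2] w(2,3) n
    by (simp add: merge_12 tg_idem)
qed simp

text \<open>At the indices 1, 2, 3 this is \<open>tg_sg_tg\<close> multiplied by \<open>sg 2\<close>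
  on the right, because \<open>merge 1 3\<close> is \<open>tg 1\<close> conjugated by
  \<open>sg 2\<close>. Coinciding indices leave idempotence or a trivial equation.\<close>

lemma merge_triangle:
  assumes "i \<in> {1..n}" "j \<in> {1..n}" "k \<in> {1..n}"
  shows "merge i j * merge j k = merge i j * merge i k"
proof (cases "i \<noteq> j \<and> i \<noteq> k \<and> j \<noteq> k")
  case True
  obtain w where w: "set w \<subseteq> {1..<n}" "swaps w 1 = i" "swaps w 2 = j" "swaps w 3 = k" "3 \<le> n"
    using word_moving3 assms True by metis
  have m13: "merge 1 3 = sg 2 * tg 1 * sg 2"
  proof -
    have "merge 1 3 = sg 2 * merge 1 2 * sg 2"
      using merge_lt.simps(2)[of 1 2] by (simp add: merge_def)
    then show ?thesis by (simp only: merge_12)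
  qed
  have tst: "tg 1 * sg 2 * tg 1 = tg 1 * tg 2"
    using tg_sg_tg[of 1] w(5) by simp
  have "tg 1 * (sg 2 * tg 1 * sg 2) = tg 1 * sg 2 * tg 1 * sg 2"
    by (simp add: mult.assoc)
  also have "\<dots> = tg 1 * (tg 2 * sg 2)"
    by (simp only: tst) (simp only: mult.assoc)
  also have "\<dots> = tg 1 * tg 2"
    using w(5) by (simp add: tg_sg)
  finally have "merge 1 2 * merge 2 3 = merge 1 2 * merge 1 3"
    unfolding m13 merge_12 merge_23 by simp
  then show ?thesis
    using merge_mult_swaps[OF w(1), of 1 2 2 3] merge_mult_swaps[OF w(1), of 1 2 1 3] w(2-5) by simp
next
  case False
  then show ?thesis using assms merge_sym[of i j] merge_idem[of i j] by auto
qed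

lemma merge_comm_adjacent:
  assumes "i \<in> {1..n}" "j \<in> {1..n}" "k \<in> {1..n}" "i \<noteq> j" "i \<noteq> k" "j \<noteq> k"
  shows "merge i j * merge j k = merge j k * merge i j"
proof -
  obtain w where w: "set w \<subseteq> {1..<n}" "swaps w 1 = i" "swaps w 2 = j" "swaps w 3 = k" "3 \<le> n"
    using word_moving3 assms by metis
  have "merge 1 2 * merge 2 3 = merge 2 3 * merge 1 2"
    using w(5) tg_comm[of 1 2] by (simp add: merge_12 merge_23)
  then show ?thesis
    using merge_mult_swaps[OF w(1), of 1 2 2 3] merge_mult_swaps[OF w(1), of 2 3 1 2] w(2-5) by simp
qed

lemma merge_comm_disjoint:
  assumes "i \<in> {1..n}" "j \<in> {1..n}" "k \<in> {1..n}" "l \<in> {1..n}" "distinct [i, j, k, l]"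
  shows "merge i j * merge k l = merge k l * merge i j"
proof -
  obtain w where w: "set w \<subseteq> {1..<n}" "swaps w 1 = i" "swaps w 2 = j" "swaps w 3 = k"
    "swaps w 4 = l" "4 \<le> n"
    using word_moving4 assms by metis
  have "merge 1 2 * merge 3 4 = merge 3 4 * merge 1 2"
    using w(6) tg_comm[of 1 3] by (simp add: merge_12 merge_34)
  then show ?thesis
    using merge_mult_swaps[OF w(1), of 1 2 3 4] merge_mult_swaps[OF w(1), of 3 4 1 2] w(2-6) by simp
qed

text \<open>Two proper pairs are disjoint or share an index; \<open>merge_sym\<close> brings a
  shared index into the middle.\<close>

lemma merge_comm:
  assumes "i \<in> {1..n}" "j \<in> {1..n}" "k \<in> {1..n}" "l \<in> {1..n}"
  shows "merge i j * merge k l = merge k l * merge i j"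
proof -
  have shared: "merge a b * merge b c = merge b c * merge a b"
    if "a \<in> {1..n}" "b \<in> {1..n}" "c \<in> {1..n}" "a \<noteq> b" "b \<noteq> c" for a b c
    using merge_comm_adjacent[of a b c] that merge_sym[of a b] by metis
  show ?thesis
  proof (cases "i = j \<or> k = l \<or> distinct [i, j, k, l]")
    case True
    then show ?thesis using merge_comm_disjoint[OF assms] by fastforce
  next
    case False
    then have ne: "i \<noteq> j" "k \<noteq> l" and "i = k \<or> i = l \<or> j = k \<or> j = l" by auto
    then consider "i = k" | "i = l" | "j = k" | "j = l" by blast
    then show ?thesis
    proof cases
      case 1
      then show ?thesis using shared[of j i l] assms ne merge_sym by metis
    next
      case 2
      then show ?thesis using shared[of j i k] assms ne merge_sym by metis
    next
      case 3
      then show ?thesis using shared[of i j l] assms ne merge_sym by metis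
    next
      case 4
      then show ?thesis using shared[of i j k] assms ne merge_sym by metis
    qed
  qed
qed

text \<open>By the Coxeter presentation \<open>w\<close> may be replaced by the conjugate
  \<open>u @ [1] @ rev u\<close>, and the claim becomes \<open>tg 1 * sg 1 = tg 1\<close>.\<close>

lemma merge_transposition:
  assumes "i \<in> {1..n}" "j \<in> {1..n}" "set w \<subseteq> {1..<n}" "swaps w = transpose i j"
  shows "merge i j * prodS w = merge i j"
proof (cases "i = j")
  case True
  then show ?thesis using prodS_eq_if_swaps_eq[of w "[]"] assms by simp
next
  case False
  then have n: "2 \<le> n" using assms by auto
  obtain u where u: "set u \<subseteq> {1..<n}" "swaps u 1 = i" "swaps u 2 = j"
    using word_moving2 assms False by metis
  have "swaps u \<circ> transpose 1 2 = transpose i j \<circ> swaps u"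
  proof
    fix x
    have "swaps u x \<noteq> i \<and> swaps u x \<noteq> j" if "x \<noteq> 1 \<and> x \<noteq> 2"
      using that u(2,3) permutes_inj[OF swaps_permutes[OF u(1)]] by (metis injD)
    then show "(swaps u \<circ> transpose 1 2) x = (transpose i j \<circ> swaps u) x"
      using u(2,3) by (cases "x = 1"; cases "x = 2") auto
  qed
  then have "swaps (u @ [1] @ rev u) = transpose i j \<circ> (swaps u \<circ> swaps (rev u))"
    by (simp add: numeral_2_eq_2 flip: comp_assoc)
  then have "swaps (u @ [1] @ rev u) = transpose i j"
    by (simp add: swaps_comp_rev)
  then have "prodS w = prodS (u @ [1] @ rev u)"
    using assms u n by (intro prodS_eq_if_swaps_eq) auto
  also have "\<dots> = prodS u * sg 1 * prodS (rev u)"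
    by (simp add: mult.assoc)
  finally have "merge i j * prodS w = prodS u * tg 1 * (prodS (rev u) * prodS u) * sg 1 * prodS (rev u)"
    using merge_swaps[OF u(1), of 1 2] u n by (simp add: mult.assoc merge_12)
  also have "\<dots> = prodS u * (tg 1 * sg 1) * prodS (rev u)"
    using prodS_rev_inverse[OF u(1)] by (simp add: mult.assoc)
  also have "\<dots> = merge i j"
    using merge_swaps[OF u(1), of 1 2] u n by (simp add: tg_sg merge_12)
  finally show ?thesis .
qed

section \<open>Products of the idempotents and what they absorb\<close>

definition merges :: "(nat \<times> nat) list \<Rightarrow> 'a" where
  "merges ps = prod_list (map (\<lambda>(i, j). merge i j) ps)"

lemma merges_simps [simp]:
  "merges [] = 1" "merges ((i, j) # ps) = merge i j * merges ps"
  by (simp_all add: merges_def)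

lemma merges_comm_merge:
  assumes "set ps \<subseteq> {1..n} \<times> {1..n}" "i \<in> {1..n}" "j \<in> {1..n}"
  shows "merges ps * merge i j = merge i j * merges ps"
  using assms(1)
proof (induction ps)
  case (Cons p ps)
  obtain k l where p: "p = (k, l)" by fastforce
  have "merges (p # ps) * merge i j = merge k l * (merge i j * merges ps)"
    using Cons by (simp add: p mult.assoc)
  also have "\<dots> = merge i j * merge k l * merges ps"
    using merge_comm[of i j k l] Cons.prems assms p by (simp flip: mult.assoc)
  finally show ?case by (simp add: p mult.assoc)
qed simp

lemma merges_comm:
  assumes "set ps \<subseteq> {1..n} \<times> {1..n}" "set qs \<subseteq> {1..n} \<times> {1..n}"
  shows "merges ps * merges qs = merges qs * merges ps"
  using assms(2)
proof (induction qs)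
  case (Cons q qs)
  obtain k l where q: "q = (k, l)" by fastforce
  have "merges ps * merges (q # qs) = merge k l * (merges ps * merges qs)"
    using merges_comm_merge[OF assms(1), of k l] Cons.prems q by (simp flip: mult.assoc)
  then show ?case using Cons by (simp add: q mult.assoc)
qed simp

lemma merges_absorb_member:
  assumes "set ps \<subseteq> {1..n} \<times> {1..n}" "(i, j) \<in> set ps"
  shows "merges ps * merge i j = merges ps"
  using assms
proof (induction ps)
  case (Cons p ps)
  obtain k l where p: "p = (k, l)" by fastforce
  show ?case
  proof (cases "p = (i, j)")
    case True
    have "merges (p # ps) * merge i j = merge i j * merge i j * merges ps"
      using merges_comm_merge[of ps i j] Cons.prems True by (simp add: mult.assoc)
    then show ?thesis using merge_idem[of i j] Cons.prems True by simp
  next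
    case False
    then show ?thesis using Cons by (auto simp: p mult.assoc)
  qed
qed simp

text \<open>The absorbed pairs form an equivalence containing \<open>ps\<close>; its transitivity is
  the triangle identity.\<close>

lemma merges_absorb_equiv:
  assumes ps: "set ps \<subseteq> {1..n} \<times> {1..n}" and "pair_equiv (set ps) i j"
  shows "merges ps * merge i j = merges ps"
proof -
  \<comment> \<open>The range conditions make the triangle identity available; the disjunct
    \<open>i = j\<close> keeps \<open>P\<close> reflexive beyond \<open>{1..n}\<close>.\<close>
  define P where "P i j \<longleftrightarrow> i = j \<or> i \<in> {1..n} \<and> j \<in> {1..n} \<and> merges ps * merge i j = merges ps" for i j
  have P_trans: "P i k" if "P i j" "P j k" for i j k
  proof (cases "i \<in> {1..n} \<and> j \<in> {1..n} \<and> k \<in> {1..n}")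
    case True
    then have "merges ps * merge i j = merges ps" "merges ps * merge j k = merges ps"
      using that by (auto simp: P_def)
    then have "merges ps * merge i k = merges ps"
      using merge_triangle[of i j k] True by (metis mult.assoc)
    then show ?thesis using True by (simp add: P_def)
  next
    case False
    then show ?thesis using that by (auto simp: P_def)
  qed
  have P_base: "P x y" if "(x, y) \<in> set ps" for x y
    using merges_absorb_member[OF ps that] that ps by (auto simp: P_def)
  have P_sym: "P y x" if "P x y" for x y
    using that by (auto simp: P_def merge_sym)
  have P_refl: "P x x" for x
    by (simp add: P_def)
  have "P i j"
    using assms(2)
    by (induction rule: pair_equiv_induct) (blast intro: P_base P_refl P_sym P_trans)+
  then show ?thesis by (auto simp: P_def)
qed

lemma merges_absorb_merges:
  assumes ps: "set ps \<subseteq> {1..n} \<times> {1..n}"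
    and "\<And>i j. (i, j) \<in> set qs \<Longrightarrow> pair_equiv (set ps) i j"
  shows "merges ps * merges qs = merges ps"
  using assms(2)
proof (induction qs)
  case (Cons q qs)
  obtain k l where q: "q = (k, l)" by fastforce
  then have "merges ps * merge k l = merges ps"
    using Cons.prems by (intro merges_absorb_equiv ps) auto
  then show ?case using Cons by (simp add: q flip: mult.assoc)
qed simp

text \<open>Each of the two products absorbs the other, and they commute.\<close>

lemma merges_eq:
  assumes "set ps \<subseteq> {1..n} \<times> {1..n}" "set qs \<subseteq> {1..n} \<times> {1..n}"
    and "pair_equiv (set ps) = pair_equiv (set qs)"
  shows "merges ps = merges qs"
proof -
  have "merges ps = merges ps * merges qs"
    using assms pair_equiv_base[of _ _ "set qs"] by (subst merges_absorb_merges) auto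
  also have "\<dots> = merges qs * merges ps"
    by (rule merges_comm[OF assms(1,2)])
  also have "\<dots> = merges qs"
    using assms pair_equiv_base[of _ _ "set ps"] by (intro merges_absorb_merges) auto
  finally show ?thesis .
qed

text \<open>A class-preserving permutation is built from transpositions of equivalent points, and
  each of these is absorbed through the idempotent of the same two points.\<close>

lemma merges_absorb_prodS:
  assumes ps: "set ps \<subseteq> {1..n} \<times> {1..n}" and w: "set w \<subseteq> {1..<n}"
    and "\<And>x. pair_equiv (set ps) (swaps w x) x"
  shows "merges ps * prodS w = merges ps"
proof -
  \<comment> \<open>The induction bounds the support of the permutation by \<open>m\<close>; the
    word keeps the whole alphabet \<open>{1..<n}\<close>.\<close>
  have "merges ps * prodS w = merges ps"
    if "m \<le> n" "set w \<subseteq> {1..<n}" "swaps w permutes {1..m}" "\<And>x. pair_equiv (set ps) (swaps w x) x"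
    for m w
    using that
  proof (induction m arbitrary: w)
    case 0
    then have "swaps w = swaps []" by auto
    then have "prodS w = prodS []" using 0 by (intro prodS_eq_if_swaps_eq) auto
    then show ?case by simp
  next
    case (Suc m)
    define k where "k = swaps w (Suc m)"
    have k: "k \<in> {1..Suc m}"
      using permutes_in_image[OF Suc.prems(3), of "Suc m"] by (simp add: k_def)
    then have "transpose k (Suc m) permutes {1..n}"
      using Suc.prems(1) by (intro permutes_swap_id) auto
    then obtain t where t: "set t \<subseteq> {1..<n}" "swaps t = transpose k (Suc m)"
      using permutes_eq_swaps by metis
    have fix1: "swaps (t @ w) (Suc m) = Suc m"
      using t by (simp flip: k_def)
    have "transpose k (Suc m) permutes {1..Suc m}"
      using k by (intro permutes_swap_id) auto
    then have "swaps (t @ w) permutes {1..Suc m}"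
      unfolding swaps_append t(2) using Suc.prems(3) permutes_compose by blast
    then have perm: "swaps (t @ w) permutes {1..m}"
      by (rule permutes_superset) (use fix1 le_Suc_eq in auto)
    have kS: "pair_equiv (set ps) k (Suc m)"
      using Suc.prems(4) by (simp add: k_def)
    then have swap: "pair_equiv (set ps) (transpose k (Suc m) y) y" for y
      using pair_equiv_sym by (auto simp: transpose_def)
    then have equ: "pair_equiv (set ps) (swaps (t @ w) x) x" for x
      unfolding swaps_append t(2) comp_apply
      using Suc.prems(4)[of x] swap pair_equiv_trans by blast
    have "merges ps * prodS (t @ w) = merges ps"
      by (rule Suc.IH[OF _ _ perm equ]) (use Suc.prems t in auto)
    \<comment> \<open>As \<open>k\<close> and \<open>Suc m\<close> are equivalent,
      \<open>merge k (Suc m)\<close> may be inserted; it swallows the transposition and is absorbed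
      again.\<close>
    moreover have tt: "merges ps * prodS t = merges ps"
    proof -
      have "merges ps * prodS t = merges ps * (merge k (Suc m) * prodS t)"
        using merges_absorb_equiv[OF ps kS] by (simp flip: mult.assoc)
      also have "\<dots> = merges ps"
        using merge_transposition[OF _ _ t] merges_absorb_equiv[OF ps kS] k Suc.prems(1) by simp
      finally show ?thesis .
    qed
    ultimately show ?case by (simp flip: mult.assoc)
  qed
  from this[OF le_refl w swaps_permutes[OF w] assms(3)] show ?thesis .
qed

end

section \<open>Words in the generators\<close>

fun word_swaps :: "generator list \<Rightarrow> nat list" where
  "word_swaps [] = []"
| "word_swaps (\<sigma> i # w) = i # word_swaps w"
| "word_swaps (\<tau> i # w) = word_swaps w"

text \<open>These are the indices of the idempotents once each \<open>\<tau>\<close> has been moved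
  to the left through the \<open>\<sigma>\<close> before it, every such \<open>\<sigma>\<close>
  applying its transposition to the pair.\<close>

fun word_pairs :: "generator list \<Rightarrow> (nat \<times> nat) list" where
  "word_pairs [] = []"
| "word_pairs (\<sigma> i # w) = map (map_prod (adj_swap i) (adj_swap i)) (word_pairs w)"
| "word_pairs (\<tau> i # w) = (i, Suc i) # word_pairs w"

abbreviation word_perm :: "generator list \<Rightarrow> nat \<Rightarrow> nat" where
  "word_perm w \<equiv> swaps (word_swaps w)"

lemma word_swaps_append [simp]: "word_swaps (u @ v) = word_swaps u @ word_swaps v"
  by (induction u rule: word_swaps.induct) simp_all

lemma word_pairs_append:
  "word_pairs (u @ v) = word_pairs u @ map (map_prod (word_perm u) (word_perm u)) (word_pairs v)"
  by (induction u rule: word_swaps.induct) (auto simp: map_prod_def id_def split_beta)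

lemma word_swaps_subset: "w \<in> lists (T_generators n) \<Longrightarrow> set (word_swaps w) \<subseteq> {1..<n}"
  by (induction w rule: word_swaps.induct) (auto simp: T_generators_def)

lemma word_perm_permutes: "w \<in> lists (T_generators n) \<Longrightarrow> word_perm w permutes {1..n}"
  by (intro swaps_permutes word_swaps_subset)

lemma word_pairs_subset:
  "w \<in> lists (T_generators n) \<Longrightarrow> set (word_pairs w) \<subseteq> {1..n} \<times> {1..n}"
proof (induction w rule: word_swaps.induct)
  case (2 i w)
  then have "adj_swap i permutes {1..n}"
    by (intro permutes_swap_id) (auto simp: T_generators_def)
  from permutes_in_image[OF this] 2 show ?case by fastforce
qed (auto simp: T_generators_def)

section \<open>Evaluation of a word as idempotents times a permutation\<close>

context factorizable_presentation
begin

definition eval_word :: "generator list \<Rightarrow> 'a" where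
  "eval_word w = prod_list (map (case_generator sg tg) w)"

lemma eval_word_simps [simp]:
  "eval_word [] = 1"
  "eval_word (\<sigma> i # w) = sg i * eval_word w"
  "eval_word (\<tau> i # w) = tg i * eval_word w"
  by (simp_all add: eval_word_def)

lemma sg_merges:
  assumes "1 \<le> k" "k < n" "set ps \<subseteq> {1..n} \<times> {1..n}"
  shows "sg k * merges ps = merges (map (map_prod (adj_swap k) (adj_swap k)) ps) * sg k"
  using assms(3)
proof (induction ps)
  case (Cons p ps)
  obtain i j where p: "p = (i, j)" by fastforce
  have "sg k * merges (p # ps) = sg k * merge i j * merges ps"
    by (simp add: p mult.assoc)
  also have "\<dots> = merge (adj_swap k i) (adj_swap k j) * (sg k * merges ps)"
    using Cons.prems assms(1,2) by (simp add: sg_merge p mult.assoc)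
  finally show ?case using Cons by (simp add: p mult.assoc)
qed simp

lemma eval_word_eq:
  assumes "w \<in> lists (T_generators n)"
  shows "eval_word w = merges (word_pairs w) * prodS (word_swaps w)"
  using assms
proof (induction w rule: word_swaps.induct)
  case (2 i w)
  then have "sg i * merges (word_pairs w) = merges (word_pairs (\<sigma> i # w)) * sg i"
    using sg_merges[of i "word_pairs w"] word_pairs_subset[of w n] by (auto simp: T_generators_def)
  then have "sg i * (merges (word_pairs w) * x) = merges (word_pairs (\<sigma> i # w)) * (sg i * x)" for x
    by (simp flip: mult.assoc)
  with 2 show ?case by simp
qed (auto simp: mult.assoc merge_Suc)

text \<open>The word \<open>?u @ rev ?v\<close> represents a class-preserving permutation. The
  idempotent part absorbs it, so the permutation factor of \<open>u\<close> may be replaced by that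
  of \<open>v\<close>.\<close>

theorem eval_word_cong:
  assumes u: "u \<in> lists (T_generators n)" and v: "v \<in> lists (T_generators n)"
    and equiv: "pair_equiv (set (word_pairs u)) = pair_equiv (set (word_pairs v))"
    and perm: "\<And>x. pair_equiv (set (word_pairs u)) (word_perm u x) (word_perm v x)"
  shows "eval_word u = eval_word v"
proof -
  let ?u = "word_swaps u" and ?v = "word_swaps v"
  let ?w = "?u @ rev ?v"
  note sub = word_swaps_subset[OF u] word_swaps_subset[OF v]
  \<comment> \<open>The hypothesis on the permutations is used at the preimage of \<open>x\<close>
    under the permutation of \<open>v\<close>.\<close>
  have "pair_equiv (set (word_pairs u)) (swaps ?w x) x" for x
    using perm[of "swaps (rev ?v) x"] swaps_comp_rev[of ?v] by (simp add: fun_eq_iff)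
  then have absorb: "merges (word_pairs u) * prodS ?w = merges (word_pairs u)"
    using sub by (intro merges_absorb_prodS word_pairs_subset u) auto
  have "prodS ?u = prodS ?w * prodS ?v"
    using prodS_rev_inverse[OF sub(2)] by (simp add: mult.assoc)
  then have "eval_word u = merges (word_pairs u) * prodS ?w * prodS ?v"
    by (simp add: eval_word_eq[OF u] mult.assoc)
  also have "\<dots> = merges (word_pairs v) * prodS ?v"
    unfolding absorb using merges_eq[OF word_pairs_subset[OF u] word_pairs_subset[OF v] equiv] by simp
  finally show ?thesis by (simp add: eval_word_eq[OF v])
qed

end

text \<open>Cayley's representation turns the carrier-based monoid \<^term>\<open>T n\<close> into elements of a
  type of class \<^class>\<open>monoid_mult\<close>.\<close>

typedef 'a endo = "UNIV :: ('a \<Rightarrow> 'a) set" ..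

instantiation endo :: (type) monoid_mult
begin

definition one_endo :: "'a endo" where
  "one_endo = Abs_endo id"

definition times_endo :: "'a endo \<Rightarrow> 'a endo \<Rightarrow> 'a endo" where
  "times_endo f g = Abs_endo (Rep_endo f \<circ> Rep_endo g)"

instance
  by standard (simp_all add: one_endo_def times_endo_def Abs_endo_inverse Rep_endo_inverse comp_assoc)

end

text \<open>Left multiplication, extended by the identity outside the carrier so that the empty word
  gives \<open>1\<close> on the whole type.\<close>

definition cayley :: "nat \<Rightarrow> generator list \<Rightarrow> generator list set endo" where
  "cayley n w = Abs_endo (\<lambda>X. if X \<in> carrier (T n)
     then word_class (T_generators n) (T_relations n) w \<otimes>\<^bsub>T n\<^esub> X else X)"

lemma cayley_Nil: "cayley n [] = 1"
proof -
  interpret monoid "T n" unfolding T_def by (rule monoid_presented_monoid)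
  have "word_class (T_generators n) (T_relations n) [] = \<one>\<^bsub>T n\<^esub>"
    by (simp add: T_def presented_monoid_def)
  then show ?thesis by (auto simp: cayley_def one_endo_def fun_eq_iff intro!: arg_cong[of _ _ Abs_endo])
qed

lemma word_class_in_T:
  "w \<in> lists (T_generators n) \<Longrightarrow> word_class (T_generators n) (T_relations n) w \<in> carrier (T n)"
  by (simp add: T_def carrier_presented_monoid)

lemma cayley_append:
  assumes "u \<in> lists (T_generators n)" "v \<in> lists (T_generators n)"
  shows "cayley n (u @ v) = cayley n u * cayley n v"
proof -
  interpret monoid "T n" unfolding T_def by (rule monoid_presented_monoid)
  have "word_class (T_generators n) (T_relations n) (u @ v) =
      word_class (T_generators n) (T_relations n) u \<otimes>\<^bsub>T n\<^esub> word_class (T_generators n) (T_relations n) v"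
    by (simp add: T_def mult_word_class assms)
  then show ?thesis
    using assms[THEN word_class_in_T]
    by (auto simp: cayley_def times_endo_def Abs_endo_inverse fun_eq_iff m_assoc
        intro!: arg_cong[of _ _ Abs_endo])
qed

text \<open>The representation is faithful: applying it to the identity element recovers the class
  of the word.\<close>

lemma cayley_eq_iff:
  assumes "u \<in> lists (T_generators n)" "v \<in> lists (T_generators n)"
  shows "cayley n u = cayley n v \<longleftrightarrow> (u, v) \<in> word_cong (T_generators n) (T_relations n)"
proof -
  interpret monoid "T n" unfolding T_def by (rule monoid_presented_monoid)
  have rep: "word_class (T_generators n) (T_relations n) w = Rep_endo (cayley n w) \<one>\<^bsub>T n\<^esub>"
    if "w \<in> lists (T_generators n)" for w
    using word_class_in_T[OF that] by (simp add: cayley_def Abs_endo_inverse)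
  have "cayley n u = cayley n v \<longleftrightarrow>
      word_class (T_generators n) (T_relations n) u = word_class (T_generators n) (T_relations n) v"
  proof
    assume "cayley n u = cayley n v"
    then show "word_class (T_generators n) (T_relations n) u = word_class (T_generators n) (T_relations n) v"
      using rep[OF assms(1)] rep[OF assms(2)] by simp
  qed (simp add: cayley_def cong: if_cong)
  then show ?thesis using word_class_eq_iff[OF assms] by simp
qed

lemma cayley_Cons:
  assumes "g # w \<in> lists (T_generators n)"
  shows "cayley n (g # w) = cayley n [g] * cayley n w"
  using cayley_append[of "[g]" n w] assms by simp

lemma cayley_relation:
  assumes "(u, v) \<in> T_relations n" "u \<in> lists (T_generators n)" "v \<in> lists (T_generators n)"
  shows "cayley n u = cayley n v"
  using assms by (simp add: cayley_eq_iff word_cong.rel)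

lemma factorizable_presentation_T:
  "factorizable_presentation n (\<lambda>i. cayley n [\<sigma> i]) (\<lambda>i. cayley n [\<tau> i])"
proof -
  have gens: "\<sigma> i \<in> T_generators n" "\<tau> i \<in> T_generators n" if "1 \<le> i" "i < n" for i
    using that by (auto simp: T_generators_def)
  \<comment> \<open>Each defining pair becomes an equation between products of images of single
    letters, the form in which the locale states its relations.\<close>
  have rel: "prod_list (map (\<lambda>g. cayley n [g]) u) = prod_list (map (\<lambda>g. cayley n [g]) v)"
    if "(u, v) \<in> T_relations n" "set u \<subseteq> T_generators n" "set v \<subseteq> T_generators n" for u v
  proof -
    have "prod_list (map (\<lambda>g. cayley n [g]) w) = cayley n w" if "set w \<subseteq> T_generators n" for w
      using that
    proof (induction w)
      case (Cons g w)
      then show ?case by (subst cayley_Cons) auto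
    qed (simp add: cayley_Nil)
    then show ?thesis using cayley_relation that by (auto simp: lists_eq_set)
  qed
  show ?thesis
  proof unfold_locales
    fix i assume "1 \<le> i" "i < n"
    note i = this and gens[OF this]
    show "cayley n [\<sigma> i] * cayley n [\<sigma> i] = 1"
      using rel[of "[\<sigma> i, \<sigma> i]" "[]"] i gens by (simp add: T_relations_def)
    show "cayley n [\<tau> i] * cayley n [\<tau> i] = cayley n [\<tau> i]"
      using rel[of "[\<tau> i, \<tau> i]" "[\<tau> i]"] i gens by (simp add: T_relations_def)
    have *: "cayley n [\<sigma> i] * cayley n [\<tau> i] = cayley n [\<tau> i]"
      using rel[of "[\<sigma> i, \<tau> i]" "[\<tau> i]"] i gens by (simp add: T_relations_def)
    then show "cayley n [\<sigma> i] * cayley n [\<tau> i] = cayley n [\<tau> i]" .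
    show "cayley n [\<tau> i] * cayley n [\<sigma> i] = cayley n [\<tau> i]"
      using rel[of "[\<tau> i, \<sigma> i]" "[\<sigma> i, \<tau> i]"] * i gens by (simp add: T_relations_def)
  next
    fix i j assume "1 \<le> i" "Suc i < j" "j < n"
    then show "cayley n [\<sigma> i] * cayley n [\<sigma> j] = cayley n [\<sigma> j] * cayley n [\<sigma> i]"
      using rel[of "[\<sigma> i, \<sigma> j]" "[\<sigma> j, \<sigma> i]"] gens[of i] gens[of j] by (simp add: T_relations_def)
  next
    fix i j assume "1 \<le> i" "i < j" "j < n"
    then show "cayley n [\<tau> i] * cayley n [\<tau> j] = cayley n [\<tau> j] * cayley n [\<tau> i]"
      using rel[of "[\<tau> i, \<tau> j]" "[\<tau> j, \<tau> i]"] gens[of i] gens[of j] by (simp add: T_relations_def)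
  next
    fix i j assume "1 \<le> i" "i < n" "1 \<le> j" "j < n" "Suc i < j \<or> Suc j < i"
    then show "cayley n [\<sigma> i] * cayley n [\<tau> j] = cayley n [\<tau> j] * cayley n [\<sigma> i]"
      using rel[of "[\<tau> j, \<sigma> i]" "[\<sigma> i, \<tau> j]"] gens[of i] gens[of j] by (auto simp: T_relations_def)
  next
    fix i assume "1 \<le> i" "Suc i < n"
    note i = this
    show "cayley n [\<sigma> i] * cayley n [\<sigma> (Suc i)] * cayley n [\<sigma> i]
        = cayley n [\<sigma> (Suc i)] * cayley n [\<sigma> i] * cayley n [\<sigma> (Suc i)]"
      using rel[of "[\<sigma> i, \<sigma> (Suc i), \<sigma> i]" "[\<sigma> (Suc i), \<sigma> i, \<sigma> (Suc i)]"] i gens[of i] gens[of "Suc i"]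
      by (simp add: T_relations_def mult.assoc)
    show "cayley n [\<sigma> i] * cayley n [\<tau> (Suc i)] * cayley n [\<sigma> i]
        = cayley n [\<sigma> (Suc i)] * cayley n [\<tau> i] * cayley n [\<sigma> (Suc i)]"
      using rel[of "[\<sigma> i, \<tau> (Suc i), \<sigma> i]" "[\<sigma> (Suc i), \<tau> i, \<sigma> (Suc i)]"] i gens[of i] gens[of "Suc i"]
      by (simp add: T_relations_def mult.assoc)
    show "cayley n [\<tau> i] * cayley n [\<sigma> (Suc i)] * cayley n [\<tau> i]
        = cayley n [\<tau> i] * cayley n [\<tau> (Suc i)]"
      using rel[of "[\<tau> i, \<sigma> (Suc i), \<tau> i]" "[\<tau> i, \<tau> (Suc i)]"] i gens[of i] gens[of "Suc i"]
      by (simp add: T_relations_def mult.assoc)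
  qed
qed

text \<open>The result for arbitrary monoids with these relations is applied to \<open>T n\<close>
  itself, where a word evaluates to its own Cayley image.\<close>

theorem word_cong_if_same_action:
  assumes u: "u \<in> lists (T_generators n)" and v: "v \<in> lists (T_generators n)"
    and "pair_equiv (set (word_pairs u)) = pair_equiv (set (word_pairs v))"
    and "\<And>x. pair_equiv (set (word_pairs u)) (word_perm u x) (word_perm v x)"
  shows "(u, v) \<in> word_cong (T_generators n) (T_relations n)"
proof -
  interpret factorizable_presentation n "\<lambda>i. cayley n [\<sigma> i]" "\<lambda>i. cayley n [\<tau> i]"
    by (rule factorizable_presentation_T)
  have "eval_word w = cayley n w" if "w \<in> lists (T_generators n)" for w
    using that
  proof (induction w rule: word_swaps.induct)
    case (2 i w)
    then show ?case using cayley_Cons[of "\<sigma> i" w n] by simp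
  next
    case (3 i w)
    then show ?case using cayley_Cons[of "\<tau> i" w n] by simp
  qed (simp add: cayley_Nil)
  with eval_word_cong[OF assms] u v show ?thesis
    by (simp add: cayley_eq_iff)
qed

section \<open>Partitions encoded by an equivalence and a permutation\<close>

text \<open>
  An element of \<open>IT n\<close> is encoded by pairs \<open>G\<close> generating the equivalence that it induces on the left
  row, and a permutation \<open>p\<close> sending each right point to a left point of its block.
\<close>

fun level :: "(nat \<Rightarrow> nat) \<Rightarrow> point \<Rightarrow> nat" where
  "level p (Left_Row, i) = i"
| "level p (Middle_Row, i) = i"
| "level p (Right_Row, i) = p i"

definition same_level :: "nat \<Rightarrow> (nat \<times> nat) set \<Rightarrow> (nat \<Rightarrow> nat) \<Rightarrow> (point \<times> point) set" where
  "same_level n G p = {(x, y). x \<in> points n \<and> y \<in> points n \<and> pair_equiv G (level p x) (level p y)}"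

definition level_partition :: "nat \<Rightarrow> (nat \<times> nat) set \<Rightarrow> (nat \<Rightarrow> nat) \<Rightarrow> point set set" where
  "level_partition n G p = points n // same_level n G p"

lemma points_iff: "(r, i) \<in> points n \<longleftrightarrow> r \<noteq> Middle_Row \<and> i \<in> {1..n}"
  by (cases r) (auto simp: points_def left_points_def right_points_def)

lemma points_cases:
  assumes "x \<in> points n"
  obtains i where "x = (Left_Row, i)" "i \<in> {1..n}" | i where "x = (Right_Row, i)" "i \<in> {1..n}"
  using assms by (auto simp: points_def left_points_def right_points_def)

lemma equiv_same_level: "equiv (points n) (same_level n G p)"
  unfolding same_level_def
  by (rule equivI) (auto simp: refl_on_def sym_def trans_def intro: pair_equiv_sym pair_equiv_trans)

lemma partition_on_level_partition: "partition_on (points n) (level_partition n G p)"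
  unfolding level_partition_def by (rule partition_on_quotient[OF equiv_same_level])

lemma block_rel_quotient:
  assumes "equiv A r"
  shows "block_rel (A // r) x y \<longleftrightarrow> (x, y) \<in> r"
proof
  assume "block_rel (A // r) x y"
  then show "(x, y) \<in> r"
    unfolding block_rel_def using assms by (meson quotient_eq_iff)
next
  assume xy: "(x, y) \<in> r"
  then have "x \<in> A" using assms by (meson equivE equiv_type mem_Sigma_iff subsetD)
  then show "block_rel (A // r) x y"
    unfolding block_rel_def using xy equiv_class_self[OF assms] by (auto intro!: bexI[of _ "r `` {x}"] quotientI)
qed

lemma block_rel_level_partition:
  "block_rel (level_partition n G p) x y \<longleftrightarrow> (x, y) \<in> same_level n G p"
  unfolding level_partition_def by (rule block_rel_quotient[OF equiv_same_level])

lemma level_partition_eq_iff: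
  "level_partition n G p = level_partition n H q \<longleftrightarrow> same_level n G p = same_level n H q"
proof
  assume "level_partition n G p = level_partition n H q"
  then have "(x, y) \<in> same_level n G p \<longleftrightarrow> (x, y) \<in> same_level n H q" for x y
    using block_rel_level_partition[of n _ _ x y] by metis
  then show "same_level n G p = same_level n H q" by auto
qed (simp add: level_partition_def)

lemma partition_eq_level_partition:
  assumes "partition_on (points n) P"
    and "\<And>x y. x \<in> points n \<Longrightarrow> y \<in> points n \<Longrightarrow>
      block_rel P x y \<longleftrightarrow> pair_equiv G (level p x) (level p y)"
  shows "P = level_partition n G p"
proof -
  have "x \<in> points n \<and> y \<in> points n" if "block_rel P x y" for x y
    using that partition_onD1[OF assms(1)] by (auto simp: block_rel_def)
  then have "same_level n G p = {(x, y). block_rel P x y}"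
    unfolding same_level_def using assms(2) by blast
  then have "same_level n G p = {(x, y). \<exists>X\<in>P. x \<in> X \<and> y \<in> X}"
    unfolding block_rel_def .
  then show ?thesis
    unfolding level_partition_def using partition_on_eq_quotient[OF assms(1)] by simp
qed

lemma level_in:
  assumes "p permutes {1..n}" "x \<in> points n"
  shows "level p x \<in> {1..n}"
  using assms(2) permutes_in_image[OF assms(1)] by (cases rule: points_cases) auto

section \<open>Products of encoded partitions\<close>

fun middle_level :: "(nat \<Rightarrow> nat) \<Rightarrow> (nat \<Rightarrow> nat) \<Rightarrow> point \<Rightarrow> nat" where
  "middle_level p q (Left_Row, i) = i"
| "middle_level p q (Middle_Row, i) = p i"
| "middle_level p q (Right_Row, i) = p (q i)"

lemma block_rel_Un: "block_rel (P \<union> Q) x y \<longleftrightarrow> block_rel P x y \<or> block_rel Q x y"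
  by (auto simp: block_rel_def)

lemma block_rel_image:
  "block_rel (image f ` P) x y \<longleftrightarrow> (\<exists>x' y'. block_rel P x' y' \<and> x = f x' \<and> y = f y')"
  by (auto simp: block_rel_def)

lemma pair_equiv_image: "pair_equiv H x y \<Longrightarrow> pair_equiv (map_prod p p ` H) (p x) (p y)"
proof (induction rule: pair_equiv_induct)
  case (base x y)
  then show ?case by (intro pair_equiv_base) force
next
  case (sym x y)
  then show ?case by (rule pair_equiv_sym)
next
  case (trans x y z)
  then show ?case by (rule pair_equiv_trans)
qed simp

text \<open>\<open>middle_level\<close> assigns to each point of the three rows a left number in its
  component. Inside a block of the first factor levels differ along \<open>G\<close>, inside a block
  of the second along the image of \<open>H\<close> under \<open>p\<close>.\<close>

lemma product_rel_imp:
  assumes "product_rel (level_partition n G p) (level_partition n H q) x y"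
  shows "pair_equiv (G \<union> map_prod p p ` H) (middle_level p q x) (middle_level p q y)"
proof -
  let ?K = "G \<union> map_prod p p ` H"
  let ?\<alpha> = "image right_to_middle ` level_partition n G p"
  let ?\<beta> = "image left_to_middle ` level_partition n H q"
  have block_step: "pair_equiv ?K (middle_level p q y) (middle_level p q z)"
    if yz: "block_rel (?\<alpha> \<union> ?\<beta>) y z" for y z
  proof -
    consider y' z' where "(y', z') \<in> same_level n G p" "y = right_to_middle y'" "z = right_to_middle z'"
      | y' z' where "(y', z') \<in> same_level n H q" "y = left_to_middle y'" "z = left_to_middle z'"
      using yz unfolding block_rel_Un block_rel_image block_rel_level_partition by blast
    then show ?thesis
    proof cases
      case 1
      have eq: "middle_level p q (right_to_middle w) = level p w" if "w \<in> points n" for w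
        using that by (cases rule: points_cases) auto
      have "pair_equiv ?K (level p y') (level p z')"
        by (rule pair_equiv_mono[of G]) (use 1 in \<open>auto simp: same_level_def intro: pair_equiv_base\<close>)
      then show ?thesis using 1 by (simp add: same_level_def eq)
    next
      case 2
      have eq: "middle_level p q (left_to_middle w) = p (level q w)" if "w \<in> points n" for w
        using that by (cases rule: points_cases) auto
      have "pair_equiv (map_prod p p ` H) (p (level q y')) (p (level q z'))"
        using 2 by (intro pair_equiv_image) (simp add: same_level_def)
      then have "pair_equiv ?K (p (level q y')) (p (level q z'))"
        by (rule pair_equiv_mono[rotated]) (auto intro: pair_equiv_base)
      then show ?thesis using 2 by (simp add: same_level_def eq)
    qed
  qed
  from assms show ?thesis
    unfolding product_rel_def
  proof (induction rule: equivclp_induct)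
    case (step y z)
    then show ?case using block_step[of y z] block_step[of z y] pair_equiv_sym pair_equiv_trans by meson
  qed simp
qed

text \<open>Every point is linked to the left point of its level. Left points are linked along
  \<open>G\<close> inside the first factor, and along the image of \<open>H\<close> by a detour
  through the middle row.\<close>

lemma imp_product_rel:
  assumes G: "G \<subseteq> {1..n} \<times> {1..n}" and H: "H \<subseteq> {1..n} \<times> {1..n}"
    and p: "p permutes {1..n}" and q: "q permutes {1..n}"
    and x: "x \<in> points n" and y: "y \<in> points n"
    and "pair_equiv (G \<union> map_prod p p ` H) (level (p \<circ> q) x) (level (p \<circ> q) y)"
  shows "product_rel (level_partition n G p) (level_partition n H q) x y"
proof -
  define R where "R = product_rel (level_partition n G p) (level_partition n H q)"
  have R_refl: "R x x" and R_sym: "R x y \<Longrightarrow> R y x" and R_trans: "R x y \<Longrightarrow> R y z \<Longrightarrow> R x z" for x y z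
    unfolding R_def product_rel_def by (auto intro: equivclp_sym equivclp_trans)
  have R_left: "R (right_to_middle x) (right_to_middle y)" if "(x, y) \<in> same_level n G p" for x y
    unfolding R_def product_rel_def
    by (rule r_into_equivclp)
      (use that in \<open>unfold block_rel_Un block_rel_image block_rel_level_partition, blast\<close>)
  have R_right: "R (left_to_middle x) (left_to_middle y)" if "(x, y) \<in> same_level n H q" for x y
    unfolding R_def product_rel_def
    by (rule r_into_equivclp)
      (use that in \<open>unfold block_rel_Un block_rel_image block_rel_level_partition, blast\<close>)
  have p_in: "p i \<in> {1..n} \<longleftrightarrow> i \<in> {1..n}" and q_in: "q i \<in> {1..n} \<longleftrightarrow> i \<in> {1..n}" for i
    using permutes_in_image[OF p] permutes_in_image[OF q] by auto
  have mid: "R (Middle_Row, i) (Left_Row, p i)" if "i \<in> {1..n}" for i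
    using R_left[of "(Right_Row, i)" "(Left_Row, p i)"] that p_in[of i]
    by (simp add: same_level_def points_iff)
  have right: "R (Right_Row, i) (Left_Row, p (q i))" if "i \<in> {1..n}" for i
    using R_right[of "(Right_Row, i)" "(Left_Row, q i)"] mid[of "q i"] that q_in[of i]
    by (auto simp: same_level_def points_iff intro: R_trans)
  have canonical: "R x (Left_Row, level (p \<circ> q) x)" if "x \<in> points n" for x
    using that by (cases rule: points_cases) (use R_refl right in auto)
  have left: "R (Left_Row, a) (Left_Row, b)" if "pair_equiv (G \<union> map_prod p p ` H) a b" for a b
    using that
  proof (induction rule: pair_equiv_induct)
    case (base a b)
    then consider "(a, b) \<in> G" | c d where "(c, d) \<in> H" "a = p c" "b = p d" by auto
    then show ?case
    proof cases
      case 1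
      then show ?thesis using R_left[of "(Left_Row, a)" "(Left_Row, b)"] pair_equiv_base[of a b G] G
        by (auto simp: same_level_def points_iff)
    next
      case 2
      then have "R (Middle_Row, c) (Middle_Row, d)" using R_right[of "(Left_Row, c)" "(Left_Row, d)"] pair_equiv_base[of c d H] H
        by (auto simp: same_level_def points_iff)
      moreover have "c \<in> {1..n}" "d \<in> {1..n}" using 2 H by auto
      ultimately show ?thesis using 2 mid R_sym R_trans by meson
    qed
  qed (use R_refl R_sym R_trans in blast)+
  have "R x y"
    using canonical[OF x] left[OF assms(7)] R_sym[OF canonical[OF y]] R_trans by blast
  then show ?thesis by (simp add: R_def)
qed

text \<open>The multiplication rule is that of a semidirect product and matches
  \<open>word_pairs_append\<close>.\<close>

lemma partition_mult_level_partition: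
  assumes "G \<subseteq> {1..n} \<times> {1..n}" "H \<subseteq> {1..n} \<times> {1..n}" "p permutes {1..n}" "q permutes {1..n}"
  shows "partition_mult n (level_partition n G p) (level_partition n H q)
    = level_partition n (G \<union> map_prod p p ` H) (p \<circ> q)"
proof -
  have eq: "middle_level p q x = level (p \<circ> q) x" if "x \<in> points n" for x
    using that by (cases rule: points_cases) auto
  have "product_rel (level_partition n G p) (level_partition n H q) x y \<longleftrightarrow>
      pair_equiv (G \<union> map_prod p p ` H) (level (p \<circ> q) x) (level (p \<circ> q) y)"
    if "x \<in> points n" "y \<in> points n" for x y
    using product_rel_imp[of n G p H q x y] imp_product_rel[OF assms that] eq that by metis
  then have "{(x, y). x \<in> points n \<and> y \<in> points n \<and>
        product_rel (level_partition n G p) (level_partition n H q) x y}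
      = same_level n (G \<union> map_prod p p ` H) (p \<circ> q)"
    unfolding same_level_def by blast
  then show ?thesis by (simp add: partition_mult_def level_partition_def)
qed

section \<open>The encoded partitions are exactly the elements of \<open>IT n\<close>\<close>

lemma level_partition_eq_image:
  assumes "p permutes {1..n}"
  shows "level_partition n G p = (\<lambda>j. same_level n G p `` {(Right_Row, j)}) ` {1..n}"
proof -
  have "\<exists>j\<in>{1..n}. same_level n G p `` {x} = same_level n G p `` {(Right_Row, j)}"
    if "x \<in> points n" for x
  proof -
    have "level p x \<in> p ` {1..n}"
      using level_in[OF assms that] permutes_image[OF assms] by simp
    then obtain j where j: "p j = level p x" "j \<in> {1..n}" by (metis imageE)
    then have "(x, (Right_Row, j)) \<in> same_level n G p"
      using that by (simp add: same_level_def points_iff)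
    then show ?thesis using j equiv_class_eq[OF equiv_same_level] by blast
  qed
  then show ?thesis
    unfolding level_partition_def quotient_def by (fastforce simp: points_iff)
qed

lemma level_class:
  assumes "p permutes {1..n}" "j \<in> {1..n}"
  shows "same_level n G p `` {(Right_Row, j)}
    = {Left_Row} \<times> {i \<in> {1..n}. pair_equiv G (p j) i} \<union>
      {Right_Row} \<times> {i \<in> {1..n}. pair_equiv G (p j) (p i)}"
  using assms(2) by (auto simp: same_level_def points_iff elim!: points_cases)

text \<open>The permutation \<open>p\<close> maps the right part of each block bijectively onto its
  left part.\<close>

lemma level_partition_in_IT:
  assumes p: "p permutes {1..n}"
  shows "level_partition n G p \<in> carrier (IT n)"
proof -
  have "X \<inter> left_points n \<noteq> {} \<and> X \<inter> right_points n \<noteq> {} \<and>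
      card (X \<inter> left_points n) = card (X \<inter> right_points n)" if X: "X \<in> level_partition n G p" for X
  proof -
    obtain j where j: "j \<in> {1..n}" "X = same_level n G p `` {(Right_Row, j)}"
      using X level_partition_eq_image[OF p] by auto
    let ?A = "{i \<in> {1..n}. pair_equiv G (p j) i}" and ?B = "{i \<in> {1..n}. pair_equiv G (p j) (p i)}"
    have L: "X \<inter> left_points n = {Left_Row} \<times> ?A" and R: "X \<inter> right_points n = {Right_Row} \<times> ?B"
      using j level_class[OF p j(1)] by (auto simp: left_points_def right_points_def)
    have "p ` ?B = ?A"
      using permutes_image[OF p] permutes_in_image[OF p] by (auto simp: image_iff) (metis permutes_surj[OF p] surjD)
    then have "card ?A = card ?B"
      using card_image[of p ?B] permutes_inj[OF p] by (metis inj_on_subset subset_UNIV)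
    moreover have "p j \<in> ?A" "j \<in> ?B"
      using j permutes_in_image[OF p] by auto
    ultimately show ?thesis unfolding L R by (auto simp: card_cartesian_product)
  qed
  then show ?thesis
    using partition_on_level_partition by (simp add: IT_def partition_monoid_def)
qed

text \<open>Equal numbers of left and right points in every block mean that both rows, labelled by
  blocks, give the same multiset. Hence some permutation \<open>p\<close> sends each right point to
  a left point of its block; \<open>G\<close> is the whole induced equivalence on the left
  row.\<close>

lemma IT_eq_level_partition:
  assumes "P \<in> carrier (IT n)"
  obtains G p where "G \<subseteq> {1..n} \<times> {1..n}" "p permutes {1..n}" "P = level_partition n G p"
proof -
  have P: "partition_on (points n) P"
    and card_eq: "\<And>X. X \<in> P \<Longrightarrow> card (X \<inter> left_points n) = card (X \<inter> right_points n)"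
    using assms by (auto simp: IT_def partition_monoid_def)
  have ex1: "\<exists>!X. X \<in> P \<and> x \<in> X" if "x \<in> points n" for x
    using that partition_onD1[OF P] partition_onD2[OF P] unfolding disjoint_def by blast
  define block where "block x = (THE X. X \<in> P \<and> x \<in> X)" for x
  have block: "block x \<in> P \<and> x \<in> block x" if "x \<in> points n" for x
    unfolding block_def by (rule theI'[OF ex1[OF that]])
  have block_eq: "block x = X \<longleftrightarrow> x \<in> X" if "x \<in> points n" "X \<in> P" for x X
    using ex1[OF that(1)] block[OF that(1)] that(2) by blast
  have block_rel: "block_rel P x y \<longleftrightarrow> block x = block y" if "x \<in> points n" "y \<in> points n" for x y
    using that block block_eq unfolding block_rel_def by metis
  have card_block: "card {i \<in> {1..n}. block (r, i) = X} = card (X \<inter> {r} \<times> {1..n})"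
    if "X \<in> P" "r \<noteq> Middle_Row" for X r
  proof -
    have "(r, i) \<in> X \<longleftrightarrow> block (r, i) = X" if "i \<in> {1..n}" for i
      using block_eq[of "(r, i)" X] that \<open>X \<in> P\<close> \<open>r \<noteq> Middle_Row\<close> by (simp add: points_iff)
    then have "X \<inter> {r} \<times> {1..n} = Pair r ` {i \<in> {1..n}. block (r, i) = X}"
      by auto
    then show ?thesis by (simp add: card_image inj_on_def)
  qed
  have "image_mset (\<lambda>i. block (Right_Row, i)) (mset_set {1..n})
      = image_mset (\<lambda>i. block (Left_Row, i)) (mset_set {1..n})"
  proof (rule multiset_eqI)
    fix X
    have *: "count (image_mset f (mset_set {1..n})) X = card {i \<in> {1..n}. f i = X}" for f :: "nat \<Rightarrow> point set"
      by (simp add: count_image_mset_eq_card_vimage)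
    show "count (image_mset (\<lambda>i. block (Right_Row, i)) (mset_set {1..n})) X
        = count (image_mset (\<lambda>i. block (Left_Row, i)) (mset_set {1..n})) X"
    proof (cases "X \<in> P")
      case True
      then show ?thesis
        using card_eq[OF True] card_block[OF True, of Left_Row] card_block[OF True, of Right_Row]
        unfolding * by (simp add: left_points_def right_points_def)
    next
      case False
      \<comment> \<open>All labels are blocks of \<open>P\<close>, so any other set occurs zero
        times in both rows.\<close>
      then have empty: "{i \<in> {1..n}. block (r, i) = X} = {}" if "r \<noteq> Middle_Row" for r
        using block that by (auto simp: points_iff)
      show ?thesis unfolding * empty[OF row.distinct(1)] empty[OF row.distinct(6)] ..
    qed
  qed
  from image_mset_eq_implies_permutes[OF finite_atLeastAtMost this]
  obtain p where p: "p permutes {1..n}"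
    and p_block: "\<forall>i\<in>{1..n}. block (Right_Row, i) = block (Left_Row, p i)" .
  define G where "G = {(i, j) \<in> {1..n} \<times> {1..n}. block (Left_Row, i) = block (Left_Row, j)}"
  have G: "pair_equiv G i j \<longleftrightarrow> block (Left_Row, i) = block (Left_Row, j)"
    if "i \<in> {1..n}" "j \<in> {1..n}" for i j
  proof
    assume "pair_equiv G i j"
    then show "block (Left_Row, i) = block (Left_Row, j)"
      by (induction rule: pair_equiv_induct) (auto simp: G_def)
  qed (use that in \<open>auto simp: G_def intro: pair_equiv_base\<close>)
  have level: "block x = block (Left_Row, level p x)" if "x \<in> points n" for x
    using that by (cases rule: points_cases) (auto simp: p_block)
  have "G \<subseteq> {1..n} \<times> {1..n}"
    by (auto simp: G_def)
  moreover note p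
  moreover have "P = level_partition n G p"
  proof (rule partition_eq_level_partition[OF P])
    fix x y assume x: "x \<in> points n" and y: "y \<in> points n"
    have "block_rel P x y \<longleftrightarrow> block x = block y"
      by (rule block_rel[OF x y])
    also have "\<dots> \<longleftrightarrow> block (Left_Row, level p x) = block (Left_Row, level p y)"
      by (simp only: level[OF x] level[OF y])
    also have "\<dots> \<longleftrightarrow> pair_equiv G (level p x) (level p y)"
      by (rule G[symmetric]) (intro level_in p x y)+
    finally show "block_rel P x y \<longleftrightarrow> pair_equiv G (level p x) (level p y)" .
  qed
  ultimately show ?thesis by (rule that)
qed

section \<open>The isomorphism\<close>

declare in_lists_conv_set [simp del]

section \<open>The identity and the generators as encoded partitions\<close>

lemma level_partition_image:
  assumes "p permutes {1..n}"
  shows "level_partition n G p = (\<lambda>j. {Left_Row} \<times> {i \<in> {1..n}. pair_equiv G (p j) i} \<union>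
    {Right_Row} \<times> {i \<in> {1..n}. pair_equiv G (p j) (p i)}) ` {1..n}"
  unfolding level_partition_eq_image[OF assms] by (intro image_cong level_class assms) auto

lemma pair_equiv_eqI:
  assumes "\<And>x y. (x, y) \<in> G \<Longrightarrow> pair_equiv H x y" "\<And>x y. (x, y) \<in> H \<Longrightarrow> pair_equiv G x y"
  shows "pair_equiv G = pair_equiv H"
  using pair_equiv_mono[of G H] pair_equiv_mono[of H G] assms by blast

lemma pair_equiv_insert_cong:
  assumes "pair_equiv G = pair_equiv H"
  shows "pair_equiv (insert p G) = pair_equiv (insert p H)"
proof -
  have insert: "pair_equiv (insert p K) x y" if "pair_equiv K x y" for K x y
    by (rule pair_equiv_mono[OF _ that]) (simp add: pair_equiv_base)
  show ?thesis
  proof (rule pair_equiv_eqI)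
    fix x y assume "(x, y) \<in> insert p G"
    then show "pair_equiv (insert p H) x y"
      using assms insert[of H x y] pair_equiv_base[of x y] by (metis insertE insertI1)
  next
    fix x y assume "(x, y) \<in> insert p H"
    then show "pair_equiv (insert p G) x y"
      using assms insert[of G x y] pair_equiv_base[of x y] by (metis insertE insertI1)
  qed
qed

lemma pair_equiv_empty: "pair_equiv {} x y \<longleftrightarrow> x = y"
proof
  assume "pair_equiv {} x y"
  then show "x = y" by (induction rule: pair_equiv_induct) auto
qed simp

lemma pair_equiv_single: "pair_equiv {(i, j)} x y \<longleftrightarrow> x = y \<or> {x, y} = {i, j}"
proof
  assume "pair_equiv {(i, j)} x y"
  then show "x = y \<or> {x, y} = {i, j}"
    by (induction rule: pair_equiv_induct) (auto simp: doubleton_eq_iff)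
next
  assume "x = y \<or> {x, y} = {i, j}"
  then show "pair_equiv {(i, j)} x y"
    using pair_equiv_base[of i j "{(i, j)}"] pair_equiv_sym by (auto simp: doubleton_eq_iff)
qed

text \<open>Any two sides of a triangle generate the same classes. The two versions serve the cases
  \<open>j = Suc i\<close> and \<open>i = Suc j\<close> of the relation between
  \<open>\<tau> i, \<sigma> j, \<tau> i\<close> and \<open>\<tau> i, \<tau> j\<close>.\<close>

lemma pair_equiv_triangle:
  "pair_equiv {(a, b), (a, c)} = pair_equiv {(a, b), (b, c)}"
  "pair_equiv {(b, c), (a, c)} = pair_equiv {(b, c), (a, b)}"
proof -
  have "pair_equiv {(a, b), (b, c)} a c" "pair_equiv {(a, b), (a, c)} b c"
    "pair_equiv {(b, c), (a, b)} a c" "pair_equiv {(b, c), (a, c)} a b"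
    by (meson insertI1 insertI2 pair_equiv_base pair_equiv_sym pair_equiv_trans)+
  then show "pair_equiv {(a, b), (a, c)} = pair_equiv {(a, b), (b, c)}"
    "pair_equiv {(b, c), (a, c)} = pair_equiv {(b, c), (a, b)}"
    by (auto intro!: pair_equiv_eqI intro: pair_equiv_base)
qed

lemma level_partition_discrete:
  assumes p: "p permutes {1..n}"
  shows "level_partition n {} p = (\<lambda>j. {(Left_Row, p j), (Right_Row, j)}) ` {1..n}"
  unfolding level_partition_image[OF p]
proof (rule image_cong)
  fix j assume "j \<in> {1..n}"
  moreover from this have "p j \<in> {1..n}" using permutes_in_image[OF p] by blast
  ultimately show "{Left_Row} \<times> {i \<in> {1..n}. pair_equiv {} (p j) i} \<union>
      {Right_Row} \<times> {i \<in> {1..n}. pair_equiv {} (p j) (p i)} = {(Left_Row, p j), (Right_Row, j)}"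
    using injD[OF permutes_inj[OF p]] by (auto simp: pair_equiv_empty)
qed simp

lemma partition_one_eq: "partition_one n = level_partition n {} id"
  using level_partition_discrete[OF permutes_id, of n] by (auto simp: partition_one_def)

lemma s_eq:
  assumes "1 \<le> i" "i < n"
  shows "s n i = level_partition n {} (adj_swap i)"
proof -
  have "adj_swap i permutes {1..n}" using assms by (intro permutes_swap_id) auto
  then have "level_partition n {} (adj_swap i) =
      (\<lambda>j. {(Left_Row, adj_swap i j), (Right_Row, j)}) ` {1..n}"
    by (rule level_partition_discrete)
  \<comment> \<open>Blocks are indexed by their right points; listing \<open>Suc i\<close> first
    gives the two exceptional blocks in the order of the definition of \<open>s\<close>.\<close>
  also have "{1..n} = {Suc i, i} \<union> {j \<in> {1..n}. j \<noteq> i \<and> j \<noteq> Suc i}"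
    using assms by auto
  also have "(\<lambda>j. {(Left_Row, adj_swap i j), (Right_Row, j)}) ` \<dots> =
      (\<lambda>j. {(Left_Row, adj_swap i j), (Right_Row, j)}) ` {Suc i, i} \<union>
      (\<lambda>j. {(Left_Row, j), (Right_Row, j)}) ` {j \<in> {1..n}. j \<noteq> i \<and> j \<noteq> Suc i}"
    unfolding image_Un by (intro arg_cong2[of _ _ _ _ "(\<union>)"] refl image_cong) auto
  also have "\<dots> = s n i"
    by (simp add: s_def setcompr_eq_image insert_commute flip: Suc_eq_plus1)
  finally show ?thesis by simp
qed

lemma rho_eq:
  assumes "1 \<le> i" "i < n"
  shows "rho n i = level_partition n {(i, Suc i)} id"
proof -
  let ?f = "\<lambda>j. {Left_Row} \<times> {k \<in> {1..n}. pair_equiv {(i, Suc i)} (id j) k} \<union>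
      {Right_Row} \<times> {k \<in> {1..n}. pair_equiv {(i, Suc i)} (id j) (id k)}"
  have "{1..n} = {i, Suc i} \<union> {j \<in> {1..n}. j \<noteq> i \<and> j \<noteq> Suc i}"
    using assms by auto
  then have "level_partition n {(i, Suc i)} id =
      ?f ` {i, Suc i} \<union> ?f ` {j \<in> {1..n}. j \<noteq> i \<and> j \<noteq> Suc i}"
    unfolding level_partition_image[OF permutes_id] by (metis image_Un)
  also have "?f ` {i, Suc i} = {{(Left_Row, i), (Left_Row, Suc i), (Right_Row, i), (Right_Row, Suc i)}}"
  proof -
    have "?f j = {(Left_Row, i), (Left_Row, Suc i), (Right_Row, i), (Right_Row, Suc i)}"
      if "j \<in> {i, Suc i}" for j
      using that assms by (auto simp: pair_equiv_single doubleton_eq_iff)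
    then show ?thesis by auto
  qed
  also have "?f ` {j \<in> {1..n}. j \<noteq> i \<and> j \<noteq> Suc i}
      = (\<lambda>j. {(Left_Row, j), (Right_Row, j)}) ` {j \<in> {1..n}. j \<noteq> i \<and> j \<noteq> Suc i}"
    by (rule image_cong) (auto simp: pair_equiv_single doubleton_eq_iff)
  also have "{{(Left_Row, i), (Left_Row, Suc i), (Right_Row, i), (Right_Row, Suc i)}} \<union>
      (\<lambda>j. {(Left_Row, j), (Right_Row, j)}) ` {j \<in> {1..n}. j \<noteq> i \<and> j \<noteq> Suc i} = rho n i"
    by (simp add: rho_def setcompr_eq_image flip: Suc_eq_plus1)
  finally show ?thesis by (rule HOL.sym)
qed

section \<open>The partition of a word and its agreement with the congruence\<close>

definition word_partition :: "nat \<Rightarrow> generator list \<Rightarrow> point set set" where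
  "word_partition n w = level_partition n (set (word_pairs w)) (word_perm w)"

lemma word_partition_append:
  assumes "u \<in> lists (T_generators n)" "v \<in> lists (T_generators n)"
  shows "word_partition n (u @ v) = partition_mult n (word_partition n u) (word_partition n v)"
  unfolding word_partition_def
  by (subst partition_mult_level_partition)
    (use assms word_pairs_subset word_perm_permutes in \<open>auto simp: word_pairs_append\<close>)

text \<open>Pairs of left points compare the equivalences; the left point \<open>?p x\<close> with
  the right point \<open>x\<close> compares the permutations. Numbers outside \<open>{1..n}\<close>
  are fixed by both permutations and alone in their classes.\<close>

lemma word_partition_eq_iff:
  assumes u: "u \<in> lists (T_generators n)" and v: "v \<in> lists (T_generators n)"
  shows "word_partition n u = word_partition n v \<longleftrightarrow>
    pair_equiv (set (word_pairs u)) = pair_equiv (set (word_pairs v)) \<and>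
    (\<forall>x. pair_equiv (set (word_pairs u)) (word_perm u x) (word_perm v x))"
    (is "?L \<longleftrightarrow> pair_equiv ?G = pair_equiv ?H \<and> (\<forall>x. pair_equiv _ (?p x) (?q x))")
proof
  assume ?L
  then have rel: "(x, y) \<in> same_level n ?G ?p \<longleftrightarrow> (x, y) \<in> same_level n ?H ?q" for x y
    by (simp add: word_partition_def level_partition_eq_iff)
  have "pair_equiv ?G a b \<longleftrightarrow> pair_equiv ?H a b" for a b
  proof (cases "a \<in> {1..n} \<and> b \<in> {1..n}")
    case True
    then show ?thesis using rel[of "(Left_Row, a)" "(Left_Row, b)"]
      by (simp add: same_level_def points_iff)
  next
    case False
    then show ?thesis
      using pair_equiv_outside[OF word_pairs_subset[OF u]] pair_equiv_outside[OF word_pairs_subset[OF v]]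
      by (metis pair_equiv_refl)
  qed
  then have GH: "pair_equiv ?G = pair_equiv ?H" by blast
  have "pair_equiv ?G (?p x) (?q x)" for x
  proof (cases "x \<in> {1..n}")
    case True
    then have "?p x \<in> {1..n}" using permutes_in_image[OF word_perm_permutes[OF u]] by blast
    then show ?thesis using rel[of "(Left_Row, ?p x)" "(Right_Row, x)"] True GH
      by (simp add: same_level_def points_iff)
  next
    case False
    then show ?thesis using word_perm_permutes[OF u] word_perm_permutes[OF v]
      by (simp add: permutes_def)
  qed
  with GH show "pair_equiv ?G = pair_equiv ?H \<and> (\<forall>x. pair_equiv ?G (?p x) (?q x))" by blast
next
  assume *: "pair_equiv ?G = pair_equiv ?H \<and> (\<forall>x. pair_equiv ?G (?p x) (?q x))"
  have "pair_equiv ?G (level ?p x) (level ?q x)" for x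
    using * by (cases "(?p, x)" rule: level.cases) auto
  then have "same_level n ?G ?p = same_level n ?H ?q"
    using * pair_equiv_sym pair_equiv_trans unfolding same_level_def by metis
  then show ?L by (simp add: word_partition_def level_partition_def)
qed

text \<open>The criterion \<open>word_partition_eq_iff\<close> avoids multiplying partitions: for
  each defining pair only adjacent transpositions and equivalences generated by at most two pairs
  have to be compared.\<close>

lemma word_partition_relation:
  assumes "(u, v) \<in> T_relations n" "u \<in> lists (T_generators n)" "v \<in> lists (T_generators n)"
  shows "word_partition n u = word_partition n v"
  unfolding word_partition_eq_iff[OF assms(2,3)]
proof -
  have diff1: "\<bar>int i - int j\<bar> = 1 \<longleftrightarrow> j = Suc i \<or> i = Suc j" for i j by auto
  have diff2: "\<bar>int i - int j\<bar> > 1 \<longleftrightarrow> Suc i < j \<or> Suc j < i" for i j by auto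
  have swap: "pair_equiv {(i, Suc i)} (adj_swap i x) x" for i x
    by (auto simp: pair_equiv_single transpose_def)
  have flip: "pair_equiv {(j, i)} = pair_equiv {(i, j)}" for i j
    by (auto simp: pair_equiv_single fun_eq_iff)
  have far: "adj_swap j i = i \<and> adj_swap j (Suc i) = Suc i" if "Suc i < j \<or> Suc j < i" for i j
    using that by auto
  have comm: "adj_swap i (adj_swap j x) = adj_swap j (adj_swap i x)"
    if "Suc i < j \<or> Suc j < i" for i j x
    using that by (auto simp: transpose_def)
  have braid: "adj_swap i (adj_swap j (adj_swap i x)) = adj_swap j (adj_swap i (adj_swap j x))"
    and conj: "pair_equiv {(adj_swap i j, adj_swap i (Suc j))} =
      pair_equiv {(adj_swap j i, adj_swap j (Suc i))}"
    if "j = Suc i \<or> i = Suc j" for i j x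
    using that by (auto simp: transpose_def)
  have tri: "pair_equiv {(i, Suc i), (adj_swap j i, adj_swap j (Suc i))} = pair_equiv {(i, Suc i), (j, Suc j)}"
      (is "pair_equiv ?A = pair_equiv ?B") if "j = Suc i \<or> i = Suc j" for i j
    using that pair_equiv_triangle(1)[of i "Suc i" "Suc (Suc i)"]
      pair_equiv_triangle(2)[of "Suc j" "Suc (Suc j)" j]
    by (auto simp: transpose_def)
  \<comment> \<open>The word \<open>\<tau> i, \<sigma> j, \<tau> i\<close> has the permutation
    \<open>adj_swap j\<close>, the word \<open>\<tau> i, \<tau> j\<close> the identity; they agree
    up to the class joining \<open>j\<close> and \<open>Suc j\<close>.\<close>
  have tri': "pair_equiv {(i, Suc i), (j, Suc j)} (adj_swap j x) x" for i j x
    by (rule pair_equiv_mono[OF _ swap[of j x]]) (auto intro: pair_equiv_base)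
  show "pair_equiv (set (word_pairs u)) = pair_equiv (set (word_pairs v)) \<and>
      (\<forall>x. pair_equiv (set (word_pairs u)) (word_perm u x) (word_perm v x))"
    using assms(1) unfolding T_relations_def diff1 diff2
    by (elim UnE CollectE exE conjE)
      (simp_all add: swap tri tri' flip far pair_equiv_empty insert_commute,
        (use comm braid conj in blast)+)
qed

text \<open>Soundness is an induction over the congruence, completeness is
  \<open>word_cong_if_same_action\<close>. The two directions make the isomorphism well defined and
  injective.\<close>

theorem word_cong_iff:
  assumes "u \<in> lists (T_generators n)" "v \<in> lists (T_generators n)"
  shows "(u, v) \<in> word_cong (T_generators n) (T_relations n) \<longleftrightarrow> word_partition n u = word_partition n v"
proof
  assume "(u, v) \<in> word_cong (T_generators n) (T_relations n)"
  then show "word_partition n u = word_partition n v"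
  proof (induction rule: word_cong.induct)
    case (append u v u' v')
    then show ?case using word_cong_lists by (metis word_partition_append)
  qed (simp_all add: word_partition_relation)
next
  assume "word_partition n u = word_partition n v"
  then show "(u, v) \<in> word_cong (T_generators n) (T_relations n)"
    using word_cong_if_same_action[OF assms] word_partition_eq_iff[OF assms] by blast
qed

section \<open>Every element of \<open>IT n\<close> comes from a word\<close>

lemma word_swaps_map_\<sigma> [simp]: "word_swaps (map \<sigma> w) = w" "word_pairs (map \<sigma> w) = []"
  by (induction w) auto

lemma map_\<sigma>_in_lists: "set w \<subseteq> {1..<n} \<Longrightarrow> map \<sigma> w \<in> lists (T_generators n)"
  by (auto simp: T_generators_def in_lists_conv_set)

lemma pairs_eq_word_pairs:
  assumes "G \<subseteq> {1..n} \<times> {1..n}"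
  obtains w where "w \<in> lists (T_generators n)" "word_perm w = id"
    "pair_equiv (set (word_pairs w)) = pair_equiv G"
proof -
  have "finite G" using assms finite_subset by blast
  then have "\<exists>w \<in> lists (T_generators n). word_perm w = id \<and>
      pair_equiv (set (word_pairs w)) = pair_equiv G"
    using assms
  proof (induction G rule: finite_induct)
    case empty
    then show ?case by (intro bexI[of _ "[]"]) auto
  next
    case (insert x G)
    obtain i j where x: "x = (i, j)" by fastforce
    obtain w where w: "w \<in> lists (T_generators n)" "word_perm w = id"
      "pair_equiv (set (word_pairs w)) = pair_equiv G"
      using insert.IH insert.prems by blast
    show ?case
    proof (cases "i = j")
      case True
      have "pair_equiv (insert x G) = pair_equiv G"
        by (rule pair_equiv_eqI) (auto simp: x True intro: pair_equiv_base)
      then show ?thesis using w by metis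
    next
      case False
      have ij: "i \<in> {1..n}" "j \<in> {1..n}" using insert.prems x by auto
      obtain u where u: "set u \<subseteq> {1..<n}" "swaps u 1 = i" "swaps u 2 = j"
        using word_moving2[OF ij False] .
      \<comment> \<open>A conjugate of \<open>\<tau> 1\<close> is put in front of \<open>w\<close>:
        its permutation is trivial and its only pair \<open>(1, 2)\<close> is carried to
        \<open>(i, j)\<close>.\<close>
      let ?w = "map \<sigma> u @ [\<tau> 1] @ map \<sigma> (rev u) @ w"
      have "\<tau> 1 \<in> T_generators n" using ij False by (auto simp: T_generators_def)
      then have "?w \<in> lists (T_generators n)"
        using w map_\<sigma>_in_lists[OF u(1)] map_\<sigma>_in_lists[of "rev u" n] u(1) by auto
      moreover have "word_perm ?w = id"
        using w(2) by (simp add: swaps_comp_rev)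
      moreover have "word_pairs ?w = (i, j) # word_pairs w"
        using u(2,3) swaps_comp_rev[of u]
        by (simp add: word_pairs_append map_prod.comp map_prod.id numeral_2_eq_2 One_nat_def)
      moreover have "pair_equiv (insert (i, j) (set (word_pairs w))) = pair_equiv (insert x G)"
        unfolding x by (rule pair_equiv_insert_cong[OF w(3)])
      ultimately show ?thesis by (intro bexI[of _ ?w]) auto
    qed
  qed
  then show ?thesis using that by blast
qed

text \<open>The word for \<open>G\<close> comes first with trivial permutation; the
  \<open>\<sigma>\<close> word for \<open>p\<close> after it contributes no pairs.\<close>

lemma IT_eq_word_partition:
  assumes "P \<in> carrier (IT n)"
  obtains w where "w \<in> lists (T_generators n)" "word_partition n w = P"
proof -
  obtain G p where G: "G \<subseteq> {1..n} \<times> {1..n}" and p: "p permutes {1..n}"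
    and P: "P = level_partition n G p"
    using IT_eq_level_partition[OF assms] .
  obtain u where u: "set u \<subseteq> {1..<n}" "swaps u = p"
    using permutes_eq_swaps[OF p] .
  obtain w where w: "w \<in> lists (T_generators n)" "word_perm w = id"
    "pair_equiv (set (word_pairs w)) = pair_equiv G"
    using pairs_eq_word_pairs[OF G] .
  have "word_partition n (w @ map \<sigma> u) = P"
    using w(2,3) u(2) by (simp add: P word_partition_def word_pairs_append level_partition_def same_level_def)
  then show ?thesis using that w(1) map_\<sigma>_in_lists[OF u(1)] by (metis append_in_lists_conv)
qed

lemma word_partition_in_IT: "w \<in> lists (T_generators n) \<Longrightarrow> word_partition n w \<in> carrier (IT n)"
  unfolding word_partition_def by (intro level_partition_in_IT word_perm_permutes)

text \<open>Membership in \<open>iso\<close> speaks only of bijectivity and multiplication, so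
  preservation of the identity is stated separately.\<close>

theorem theorem14:
  fixes n :: nat
  shows "\<exists>\<phi>. \<phi> \<in> iso (T n) (IT n) \<and> \<phi> \<one>\<^bsub>T n\<^esub> = \<one>\<^bsub>IT n\<^esub> \<and>
    (\<forall>i\<in>{1..<n}. \<phi> (T_class n (\<sigma> i)) = s n i \<and> \<phi> (T_class n (\<tau> i)) = rho n i)"
proof -
  let ?L = "lists (T_generators n)" and ?C = "word_class (T_generators n) (T_relations n)"
  \<comment> \<open>The value is read off an arbitrary representative; \<open>word_cong_iff\<close>
    makes it independent of the choice.\<close>
  define \<phi> where "\<phi> X = word_partition n (SOME w. w \<in> X)" for X
  have phi_class: "\<phi> (?C w) = word_partition n w" if "w \<in> ?L" for w
  proof -
    have "w \<in> ?C w" using that by (simp add: word_class_def word_cong.refl)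
    then have "(SOME v. v \<in> ?C w) \<in> ?C w" by (rule someI)
    then have "(w, SOME v. v \<in> ?C w) \<in> word_cong (T_generators n) (T_relations n)"
      by (simp add: word_class_def)
    then show ?thesis
      unfolding \<phi>_def using word_cong_iff word_cong_lists by metis
  qed
  have carrier: "carrier (T n) = ?C ` ?L"
    by (simp add: T_def carrier_presented_monoid)
  have hom: "\<phi> \<in> hom (T n) (IT n)"
  proof (rule homI)
    fix X assume "X \<in> carrier (T n)"
    then obtain w where "w \<in> ?L" "X = ?C w" unfolding carrier by blast
    then show "\<phi> X \<in> carrier (IT n)"
      by (simp only: phi_class word_partition_in_IT)
  next
    fix X Y assume "X \<in> carrier (T n)" "Y \<in> carrier (T n)"
    then obtain u v where uv: "u \<in> ?L" "v \<in> ?L" "X = ?C u" "Y = ?C v"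
      unfolding carrier by blast
    have "X \<otimes>\<^bsub>T n\<^esub> Y = ?C (u @ v)"
      using uv by (simp add: T_def mult_word_class)
    then have "\<phi> (X \<otimes>\<^bsub>T n\<^esub> Y) = word_partition n (u @ v)"
      using uv phi_class[of "u @ v"] by simp
    then show "\<phi> (X \<otimes>\<^bsub>T n\<^esub> Y) = \<phi> X \<otimes>\<^bsub>IT n\<^esub> \<phi> Y"
      using uv phi_class by (simp add: word_partition_append IT_def partition_monoid_def)
  qed
  have "bij_betw \<phi> (carrier (T n)) (carrier (IT n))"
  proof (rule bij_betw_imageI)
    show "inj_on \<phi> (carrier (T n))"
      unfolding carrier
    proof (intro inj_onI, elim imageE)
      fix X Y u v assume "\<phi> X = \<phi> Y" "X = ?C u" "Y = ?C v" "u \<in> ?L" "v \<in> ?L"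
      then show "X = Y" by (simp add: phi_class word_class_eq_iff word_cong_iff)
    qed
    show "\<phi> ` carrier (T n) = carrier (IT n)"
    proof
      show "carrier (IT n) \<subseteq> \<phi> ` carrier (T n)"
      proof
        fix P assume "P \<in> carrier (IT n)"
        then obtain w where "w \<in> ?L" "word_partition n w = P" by (rule IT_eq_word_partition)
        then show "P \<in> \<phi> ` carrier (T n)" using phi_class carrier by blast
      qed
    next
      show "\<phi> ` carrier (T n) \<subseteq> carrier (IT n)"
        using hom unfolding hom_def by blast
    qed
  qed
  with hom have "\<phi> \<in> iso (T n) (IT n)"
    by (simp add: iso_def)
  moreover have "\<phi> \<one>\<^bsub>T n\<^esub> = \<one>\<^bsub>IT n\<^esub>"
    using phi_class[of "[]"]
    by (simp add: T_def presented_monoid_def IT_def partition_monoid_def partition_one_eq word_partition_def)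
  moreover have "\<phi> (T_class n (\<sigma> i)) = s n i" "\<phi> (T_class n (\<tau> i)) = rho n i" if "i \<in> {1..<n}" for i
    using that phi_class[of "[\<sigma> i]"] phi_class[of "[\<tau> i]"]
    by (auto simp: T_class_def T_generators_def word_partition_def s_eq rho_eq)
  ultimately show ?thesis by blast
qed

end
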